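(* Let $p\ge 2$ and $m\ge 1$ be integers, and let $A\in\mathcal{M}_1$, i.e. $A$ is a nonsingular $M$-matrix whose diagonal entries are all in $(0,1]$. Then the sequence $\{X_k\}_{k\ge 0}$ generated by Schröder's method for $A^{1/p}$ is monotonically decreasing (i.e. $X_k\ge X_{k+1}$ entrywise for all $k\ge 0$) and converges to $A^{1/p}$.
   Context: A real square matrix $A$ is a nonsingular $M$-matrix if $A=sI-N$ with $N\ge 0$ entrywise and $s>\rho(N)$, where $\rho$ is the spectral radius. $\mathcal{M}_1$ is the set of all nonsingular $M$-matrices whose diagonal entries are in $(0,1]$. $A^{1/p}$ is the principal $p$th root of $A$: the unique matrix $X$ with $X^p=A$ whose eigenvalues all lie in the sector $\{z\ne 0: |\arg z|<\pi/p\}$. For real $x$ and integer $i\ge 0$, $(x)_i=x(x+1)\cdots(x+i-1)$, with $(x)_0=1$. Let $b_0=1$, $b_i=\frac{(-1/p)_i}{i!}$ for $i\ge 1$ (the coefficients in $(1-t)^{1/p}=\sum_{i\ge 0} b_i t^i$), and $T_m(t)=\sum_{i=0}^m b_i t^i$. Schröder's method (with parameter $m$) for $A^{1/p}$ is the iteration $X_0=I$, $X_{k+1}=X_k\,T_m(R(X_k))$ with $R(X_k)=I-AX_k^{-p}$, for $k\ge 0$ (for the matrices $A$ considered here all $X_k$ are nonsingular, so the sequence is well defined). *)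

theory Defs
  imports "HOL-Analysis.Analysis" "Jordan_Normal_Form.Spectral_Radius"
    "Jordan_Normal_Form.Gauss_Jordan_Elimination"
begin

definition nonsingular_M_matrix :: "real mat \<Rightarrow> bool" where
  "nonsingular_M_matrix A \<longleftrightarrow> square_mat A \<and>
     (\<exists>s N. N \<in> carrier_mat (dim_row A) (dim_row A) \<and> 0\<^sub>m (dim_row A) (dim_row A) \<le> N \<and>
        spectral_radius (map_mat complex_of_real N) < s \<and>
        A = s \<cdot>\<^sub>m 1\<^sub>m (dim_row A) - N)"

definition M1_matrices :: "real mat set" where
  "M1_matrices = {A. nonsingular_M_matrix A \<and> (\<forall>i < dim_row A. A $$ (i, i) \<in> {0<..1})}"

definition is_principal_root :: "nat \<Rightarrow> complex mat \<Rightarrow> complex mat \<Rightarrow> bool" where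
  "is_principal_root p A X \<longleftrightarrow>
     X \<in> carrier_mat (dim_row A) (dim_row A) \<and> X ^\<^sub>m p = A \<and>
     (\<forall>z. eigenvalue X z \<longrightarrow> z \<noteq> 0 \<and> \<bar>Arg z\<bar> < pi / real p)"

definition principal_root :: "nat \<Rightarrow> complex mat \<Rightarrow> complex mat" where
  "principal_root p A = (THE X. is_principal_root p A X)"

definition root_coeff :: "nat \<Rightarrow> nat \<Rightarrow> real" where
  "root_coeff p i = pochhammer (- 1 / real p) i / fact i"

(* The matrix polynomial b_0 I + b_1 R + ... + b_m R^m, written entrywise because
   matrices of a fixed dimension do not form a type. *)
definition T_mat :: "nat \<Rightarrow> nat \<Rightarrow> real mat \<Rightarrow> real mat" where
  "T_mat p m R = mat (dim_row R) (dim_row R)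
     (\<lambda>(i, j). \<Sum>l\<le>m. root_coeff p l * (R ^\<^sub>m l) $$ (i, j))"

(* "the (mat_inverse X)" is the inverse of X only when X is nonsingular. *)
definition residual :: "nat \<Rightarrow> real mat \<Rightarrow> real mat \<Rightarrow> real mat" where
  "residual p A X = 1\<^sub>m (dim_row A) - A * (the (mat_inverse X) ^\<^sub>m p)"

primrec schroeder :: "nat \<Rightarrow> nat \<Rightarrow> real mat \<Rightarrow> nat \<Rightarrow> real mat" where
  "schroeder p m A 0 = 1\<^sub>m (dim_row A)"
| "schroeder p m A (Suc k) =
     schroeder p m A k * T_mat p m (residual p A (schroeder p m A k))"

end

theory Submission
  imports Defs
begin

text \<open>
  Write \<open>A = I - B\<close>; then \<open>B \<ge> 0\<close> and \<open>\<Sum>l. B\<^sup>l\<close> converges, so power series with bounded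
  coefficients can be evaluated at \<open>B\<close>, and the iteration can be run in the ring of formal power
  series on the scalar \<open>1 - t\<close>. There \<open>r\<^sub>k\<^sub>+\<^sub>1 = f(r\<^sub>k)\<close> with \<open>f(t) = 1 - (1 - t) T(t)\<^sup>-\<^sup>p\<close>, and
  \<open>f' = K t\<^sup>m T\<^sup>-\<^sup>p\<^sup>-\<^sup>1\<close> with \<open>K \<ge> 0\<close>, so \<open>f\<close>, and by a similar computation \<open>T f\<close>, has nonnegative
  coefficients. Inductively \<open>r\<^sub>k\<close>, \<open>x\<^sub>k r\<^sub>k\<close> and \<open>x\<^sub>k - x\<^sub>k\<^sub>+\<^sub>1 = x\<^sub>k (1 - T(r\<^sub>k))\<close> have nonnegative
  coefficients, while \<open>x\<^sub>k\<close> agrees with \<open>u(t) = (1 - t)\<^sup>1\<^sup>/\<^sup>p\<close> up to degree \<open>k\<close>. Dominated convergence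
  gives \<open>X\<^sub>k \<rightarrow> u(B)\<close>.

  The matrix \<open>u(B)\<close> is the principal root because an eigenvalue of \<open>u(B)\<close> has an eigenvector in common
  with \<open>B\<close>, hence equals \<open>(1 - \<beta>)\<^sup>1\<^sup>/\<^sup>p\<close> for some \<open>\<bar>\<beta>\<bar> < 1\<close>. Any other principal root \<open>Y\<close> commutes with
  \<open>u(B)\<close>; if \<open>D = u(B) - Y\<close> were nonzero, a common eigenvector in the range of \<open>D\<close> would be annihilated
  by \<open>\<Sum>i<p. u(B)\<^sup>i Y\<^sup>p\<^sup>-\<^sup>1\<^sup>-\<^sup>i\<close>, although it has the same nonzero eigenvalue under both roots.
\<close>

section \<open>The iteration on formal power series\<close>

definition fps_nonneg :: "real fps \<Rightarrow> bool" where
  "fps_nonneg F \<longleftrightarrow> (\<forall>n. 0 \<le> fps_nth F n)"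

lemma fps_nonnegD: "fps_nonneg F \<Longrightarrow> 0 \<le> fps_nth F n"
  by (simp add: fps_nonneg_def)

lemma fps_nonneg_one [simp]: "fps_nonneg 1"
  and fps_nonneg_X [simp]: "fps_nonneg fps_X"
  by (simp_all add: fps_nonneg_def fps_X_def)

lemma fps_nonneg_add: "fps_nonneg F \<Longrightarrow> fps_nonneg G \<Longrightarrow> fps_nonneg (F + G)"
  by (simp add: fps_nonneg_def)

lemma fps_nonneg_mult: "fps_nonneg F \<Longrightarrow> fps_nonneg G \<Longrightarrow> fps_nonneg (F * G)"
  by (auto simp: fps_nonneg_def fps_mult_nth intro!: sum_nonneg)

lemma fps_nonneg_power: "fps_nonneg F \<Longrightarrow> fps_nonneg (F ^ k)"
  by (induction k) (auto intro: fps_nonneg_mult)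

lemma fps_nonneg_const: "0 \<le> c \<Longrightarrow> fps_nonneg (fps_const c)"
  by (simp add: fps_nonneg_def)

lemma fps_nonneg_compose: "fps_nonneg F \<Longrightarrow> fps_nonneg G \<Longrightarrow> fps_nonneg (F oo G)"
  using fps_nonneg_power[of G]
  by (auto simp: fps_nonneg_def fps_compose_nth intro!: sum_nonneg)

text \<open>Comparing coefficients in \<open>F * inverse F = 1\<close> expresses each coefficient of
  the inverse through earlier ones, with the nonnegative weights
  \<open>- fps_nth F i\<close>.\<close>

lemma fps_nonneg_inverse:
  assumes "fps_nth F 0 = 1" and "\<And>n. n > 0 \<Longrightarrow> fps_nth F n \<le> 0"
  shows "fps_nonneg (inverse F)"
  unfolding fps_nonneg_def
proof
  fix n
  show "0 \<le> fps_nth (inverse F) n"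
  proof (induction n rule: less_induct)
    case (less n)
    show ?case
    proof (cases "n = 0")
      case True
      then show ?thesis using assms(1) by simp
    next
      case False
      have "F * inverse F = 1"
        using assms(1) by (metis inverse_mult_eq_1' zero_neq_one)
      then have "0 = fps_nth (F * inverse F) n" using False by simp
      also have "\<dots> = (\<Sum>i=0..n. fps_nth F i * fps_nth (inverse F) (n - i))"
        by (simp add: fps_mult_nth)
      also have "\<dots> = fps_nth (inverse F) n + (\<Sum>i=Suc 0..n. fps_nth F i * fps_nth (inverse F) (n - i))"
        using assms(1) by (simp add: sum.atLeast_Suc_atMost)
      finally have "fps_nth (inverse F) n = (\<Sum>i=Suc 0..n. - fps_nth F i * fps_nth (inverse F) (n - i))"
        by (simp add: sum_negf)
      moreover have "0 \<le> \<dots>"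
        using less assms(2) by (intro sum_nonneg mult_nonneg_nonneg) auto
      ultimately show ?thesis by simp
    qed
  qed
qed

lemma fps_nonneg_if_deriv:
  assumes "0 \<le> fps_nth F 0" and "fps_nonneg (fps_deriv F)"
  shows "fps_nonneg F"
  unfolding fps_nonneg_def
proof
  fix n
  show "0 \<le> fps_nth F n"
  proof (cases n)
    case (Suc k)
    have "0 \<le> fps_nth (fps_deriv F) k" using assms(2) by (rule fps_nonnegD)
    then show ?thesis using Suc by (simp add: zero_le_mult_iff)
  qed (use assms in simp)
qed

lemma fps_eq_X_mult_shift: "fps_nth F 0 = (0::'a::comm_ring_1) \<Longrightarrow> F = fps_X * fps_shift 1 F"
  by (rule fps_ext) simp

lemma fps_compose_zero_nth:
  fixes H R :: "real fps"
  assumes "fps_nth H 0 = 0" and "fps_nth R 0 = 0"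
  shows "H oo R = R * (fps_shift 1 H oo R)"
  using fps_compose_mult_distrib[OF assms(2), of fps_X "fps_shift 1 H"]
    fps_eq_X_mult_shift[OF assms(1)] fps_X_fps_compose_startby0[OF assms(2)] by simp

lemma fps_nonneg_shift: "fps_nonneg F \<Longrightarrow> fps_nonneg (fps_shift k F)"
  by (simp add: fps_nonneg_def)

text \<open>The series \<open>Y\<close> may have negative coefficients: it will be an iterate. Since
  \<open>H\<close> has no constant term, \<open>H oo R\<close> supplies a factor \<open>R\<close>,
  and only \<open>Y * R\<close> has to be nonnegative.\<close>

lemma fps_nonneg_mult_compose:
  assumes "fps_nonneg (Y * R)" and "fps_nonneg R" and "fps_nth R 0 = 0"
    and "fps_nonneg H" and "fps_nth H 0 = 0"
  shows "fps_nonneg (Y * (H oo R))"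
proof -
  have "Y * (H oo R) = (Y * R) * (fps_shift 1 H oo R)"
    unfolding fps_compose_zero_nth[OF assms(5,3)] by (simp only: mult.assoc)
  then show ?thesis
    using assms by (simp only: fps_nonneg_mult fps_nonneg_compose fps_nonneg_shift)
qed

section \<open>The coefficients of (1 - t)^(1/p)\<close>

lemma root_coeff_0 [simp]: "root_coeff p 0 = 1"
  by (simp add: root_coeff_def)

lemma root_coeff_Suc:
  "root_coeff p (Suc i) = root_coeff p i * ((real i - 1 / real p) / real (Suc i))"
  by (simp add: root_coeff_def pochhammer_Suc field_simps)

text \<open>From \<open>i = 1\<close> on, the ratio \<open>(i - 1/p) / (i + 1)\<close> of
  consecutive coefficients lies in [0, 1], so the first one, \<open>- 1/p\<close>, fixes the sign
  and the modulus never grows.\<close>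

lemma root_coeff_bounds:
  assumes "p \<ge> 1" and "i \<ge> 1"
  shows "root_coeff p i \<le> 0 \<and> -1 \<le> root_coeff p i"
  using assms(2)
proof (induction i rule: nat_induct_at_least)
  case base
  then show ?case using assms(1) by (simp add: root_coeff_def)
next
  case (Suc i)
  define q where "q = (real i - 1 / real p) / real (Suc i)"
  have "0 \<le> 1 / real p" "1 / real p \<le> 1" "1 \<le> real i" using assms(1) Suc(1) by auto
  then have "0 \<le> real i - 1 / real p" "real i - 1 / real p \<le> real (Suc i)" by linarith+
  then have q: "0 \<le> q" "q \<le> 1" unfolding q_def by (simp_all del: of_nat_Suc)
  have "root_coeff p (Suc i) = root_coeff p i * q" by (simp add: root_coeff_Suc q_def)
  moreover have "root_coeff p i * q \<le> 0" using Suc q by (simp add: mult_nonpos_nonneg)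
  moreover have "(- root_coeff p i) * q \<le> 1 * 1" using Suc q by (intro mult_mono) auto
  ultimately show ?case by simp
qed

lemma root_coeff_abs_le:
  assumes "p \<ge> 1"
  shows "\<bar>root_coeff p i\<bar> \<le> 1"
  using root_coeff_bounds[OF assms, of i] by (cases "i = 0") auto

text \<open>This is the differential equation \<open>p (1 - t) u' = - u\<close> of
  \<open>u = (1 - t)^(1/p)\<close>, read off at degree \<open>i\<close>.\<close>

lemma root_coeff_rec:
  assumes "p \<ge> 1"
  shows "real p * (real (Suc i) * root_coeff p (Suc i) - real i * root_coeff p i) = - root_coeff p i"
proof -
  define c where "c = real (Suc i) * root_coeff p (Suc i)"
  have c: "c = root_coeff p i * (real i - 1 / real p)"
    unfolding c_def root_coeff_Suc by (simp del: of_nat_Suc)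
  show ?thesis unfolding c_def[symmetric] c using assms by (simp add: field_simps)
qed

definition root_fps :: "nat \<Rightarrow> real fps" where
  "root_fps p = Abs_fps (root_coeff p)"

definition schroeder_fps :: "nat \<Rightarrow> nat \<Rightarrow> real fps" where
  "schroeder_fps p m = Abs_fps (\<lambda>i. if i \<le> m then root_coeff p i else 0)"

text \<open>The map that one step induces on residuals: if \<open>x^p (1 - r) = 1 - t\<close>, then
  replacing \<open>x\<close> by \<open>x T(r)\<close> replaces \<open>r\<close> by this series
  composed with \<open>r\<close>.\<close>

definition residual_fps :: "nat \<Rightarrow> nat \<Rightarrow> real fps" where
  "residual_fps p m = 1 - (1 - fps_X) * inverse (schroeder_fps p m) ^ p"

lemma root_fps_ode:
  assumes "p \<ge> 1"
  shows "of_nat p * (1 - fps_X) * fps_deriv (root_fps p) = - root_fps p"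
proof (rule fps_ext)
  fix i
  have "real p * (real (Suc i) * root_coeff p (Suc i) - real i * root_coeff p i) = - root_coeff p i"
    using assms by (rule root_coeff_rec)
  then show "fps_nth (of_nat p * (1 - fps_X) * fps_deriv (root_fps p)) i = fps_nth (- root_fps p) i"
    by (cases i) (simp_all add: root_fps_def fps_mult_of_nat_nth mult.assoc left_diff_distrib)
qed

text \<open>The power \<open>W\<close> satisfies \<open>(1 - t) W' = - W\<close>. In the resulting
  recurrence the factor \<open>i - 1\<close> vanishes at \<open>i = 1\<close>, which kills every
  coefficient from degree 2 on.\<close>

lemma root_fps_power:
  assumes "p \<ge> 1"
  shows "root_fps p ^ p = 1 - fps_X"
proof -
  define W where "W = root_fps p ^ p"
  have W0: "fps_nth W 0 = 1" by (simp add: W_def root_fps_def fps_power_zeroth)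
  have "(1 - fps_X) * fps_deriv W
      = (of_nat p * (1 - fps_X) * fps_deriv (root_fps p)) * root_fps p ^ (p - 1)"
    by (simp add: W_def fps_deriv_power' algebra_simps)
  also have "\<dots> = - W"
    unfolding root_fps_ode[OF assms] W_def
    using assms power_minus_mult[of p "root_fps p"] by (simp add: mult.commute[of "root_fps p"])
  finally have ode: "(1 - fps_X) * fps_deriv W = - W" .
  have rec: "real (Suc i) * fps_nth W (Suc i) = (real i - 1) * fps_nth W i" for i
  proof -
    have "fps_nth ((1 - fps_X) * fps_deriv W) i = - fps_nth W i" using ode by simp
    then show ?thesis by (cases i) (simp_all add: algebra_simps)
  qed
  have W1: "fps_nth W 1 = -1" using rec[of 0] W0 by simp
  have "fps_nth W (i + 2) = 0" for i
  proof (induction i)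
    case 0
    then show ?case using rec[of 1] by (simp add: numeral_2_eq_2)
  next
    case (Suc i)
    then show ?case using rec[of "i + 2"] by simp
  qed
  then have "fps_nth W i = 0" if "i \<ge> 2" for i
    using that by (metis le_add_diff_inverse2)
  then have "fps_nth W i = fps_nth (1 - fps_X) i" for i
    using W0 W1 by (cases "i = 0"; cases "i = 1") (auto simp: fps_X_def)
  then show ?thesis unfolding W_def by (intro fps_ext) auto
qed

section \<open>The truncated series and the residual map\<close>

context
  fixes p m :: nat
  assumes p: "p \<ge> 2" and m: "m \<ge> 1"
begin

private abbreviation (input) "TT \<equiv> schroeder_fps p m"
private abbreviation (input) "EE \<equiv> inverse (schroeder_fps p m)"
private abbreviation (input) "ff \<equiv> residual_fps p m"

lemma schroeder_fps_nth_0 [simp]: "fps_nth (schroeder_fps p m) 0 = 1"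
  by (simp add: schroeder_fps_def)

lemma schroeder_fps_mult_inverse: "TT * EE = 1"
  by (rule inverse_mult_eq_1') simp

lemma schroeder_fps_nonneg_inverse: "fps_nonneg EE"
  using root_coeff_bounds[of p] p
  by (intro fps_nonneg_inverse) (auto simp: schroeder_fps_def)

lemma one_minus_schroeder_fps_nonneg: "fps_nonneg (1 - TT)"
  unfolding fps_nonneg_def
proof
  fix n
  show "0 \<le> fps_nth (1 - TT) n"
    using root_coeff_bounds[of p n] p by (cases "n = 0") (auto simp: schroeder_fps_def)
qed

text \<open>Truncation leaves the defect \<open>(1 - p m) b_m\<close> at degree \<open>m\<close>,
  where \<open>b_(m+1)\<close> is missing; it is written as a product of two nonnegative
  factors.\<close>

definition ode_const :: real where
  "ode_const = (real p * real m - 1) * (- root_coeff p m)"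

lemma ode_const_nonneg: "0 \<le> ode_const"
proof -
  have "1 * 1 \<le> real p * real m" using p m by (intro mult_mono) auto
  then show ?thesis using root_coeff_bounds[of p m] p m
    unfolding ode_const_def by (intro mult_nonneg_nonneg) auto
qed

text \<open>The truncation \<open>T\<close> satisfies the differential equation \<open>p (1 - t) u' + u = 0\<close> of
  \<open>(1 - t)\<^sup>1\<^sup>/\<^sup>p\<close> up to a single monomial with nonnegative coefficient.\<close>

lemma schroeder_fps_ode:
  "of_nat p * (1 - fps_X) * fps_deriv TT + TT = fps_const ode_const * fps_X ^ m"
proof (rule fps_ext)
  fix i
  have rec: "real p * (real (Suc i) * root_coeff p (Suc i) - real i * root_coeff p i) = - root_coeff p i" for i
    using p by (intro root_coeff_rec) simp
  have "fps_nth (of_nat p * (1 - fps_X) * fps_deriv TT + TT) i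
    = real p * (real (Suc i) * fps_nth TT (Suc i) - real i * fps_nth TT i) + fps_nth TT i"
    by (cases i) (simp_all add: fps_mult_of_nat_nth mult.assoc left_diff_distrib)
  also have "\<dots> = (if i = m then ode_const else 0)"
    using rec[of i] by (auto simp: schroeder_fps_def ode_const_def algebra_simps)
  finally show "fps_nth (of_nat p * (1 - fps_X) * fps_deriv TT + TT) i
    = fps_nth (fps_const ode_const * fps_X ^ m) i" by simp
qed

lemma fps_deriv_residual_fps:
  "fps_deriv ff = fps_const ode_const * fps_X ^ m * EE ^ Suc p"
proof -
  have dE: "fps_deriv EE = - fps_deriv TT * EE ^ 2" by (rule fps_inverse_deriv) simp
  have Ep: "EE ^ p = EE ^ (p - 1) * EE" using p by (metis power_minus_mult zero_less_numeral order_less_le_trans)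
  have "fps_deriv ff = EE ^ p - (1 - fps_X) * (of_nat p * fps_deriv EE * EE ^ (p - 1))"
    unfolding residual_fps_def by (simp add: fps_deriv_power' del: power_Suc)
  \<comment> \<open>The factor \<open>TT * EE = 1\<close> is inserted so that
    \<open>EE ^ Suc p\<close> can be taken out of both summands, which leaves the left-hand side of
    the differential equation.\<close>
  also have "\<dots> = (TT * EE) * EE ^ p + of_nat p * (1 - fps_X) * fps_deriv TT * EE ^ 2 * EE ^ (p - 1)"
    unfolding dE schroeder_fps_mult_inverse by (simp add: algebra_simps)
  also have "\<dots> = (of_nat p * (1 - fps_X) * fps_deriv TT + TT) * EE ^ Suc p"
    using Ep by (simp add: algebra_simps power2_eq_square)
  finally show ?thesis unfolding schroeder_fps_ode .
qed

lemma fps_nonneg_X_power: "fps_nonneg (fps_X ^ k)"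
  by (rule fps_nonneg_power) simp

text \<open>The derivative is a product of nonnegative series with the factor
  \<open>fps_X ^ m\<close>; integrating from constant term 0 gives both claims.\<close>

lemma residual_fps_nonneg: "fps_nonneg ff"
  and residual_fps_nth_low: "n \<le> m \<Longrightarrow> fps_nth ff n = 0"
proof -
  have f0: "fps_nth ff 0 = 0" by (simp add: residual_fps_def fps_power_zeroth)
  show "fps_nonneg ff"
  proof (rule fps_nonneg_if_deriv)
    show "fps_nonneg (fps_deriv ff)"
      unfolding fps_deriv_residual_fps
      by (intro fps_nonneg_mult fps_nonneg_const fps_nonneg_X_power fps_nonneg_power
          ode_const_nonneg schroeder_fps_nonneg_inverse)
  qed (simp add: f0)
  show "fps_nth ff n = 0" if "n \<le> m" for n
  proof (cases n)
    case (Suc i)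
    have "fps_nth (fps_deriv ff) i = fps_nth (fps_X ^ m * (fps_const ode_const * EE ^ Suc p)) i"
      unfolding fps_deriv_residual_fps by (simp only: mult.assoc mult.left_commute)
    also have "\<dots> = 0" using that Suc by (simp add: fps_X_power_mult_nth del: power_Suc)
    finally show ?thesis using Suc by simp
  qed (use f0 in simp)
qed

text \<open>With \<open>E = 1 / T\<close> the product is \<open>H = T - (1 - t) E^(p-1)\<close>, and
  \<open>p H'\<close> is \<open>p T'\<close> plus a nonnegative series. The possibly negative part
  \<open>p T'\<close> only has degrees below \<open>m\<close>, while \<open>H\<close> vanishes up to
  degree \<open>m\<close>.\<close>

lemma schroeder_mult_residual_fps_nonneg: "fps_nonneg (TT * ff)"
proof -
  define H where "H = TT * ff"
  have low: "fps_nth H n = 0" if "n \<le> m" for n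
    unfolding H_def fps_mult_nth using that by (intro sum.neutral) (simp add: residual_fps_nth_low)
  define T E where "T = TT" and "E = EE"
  define M where "M = fps_const ode_const * fps_X ^ m"
  have dE: "fps_deriv E = - fps_deriv T * E ^ 2"
    unfolding T_def E_def by (rule fps_inverse_deriv) simp
  have TE: "T * E = 1" unfolding T_def E_def by (rule schroeder_fps_mult_inverse)
  have ode: "of_nat p * (1 - fps_X) * fps_deriv T = M - T"
    using schroeder_fps_ode unfolding T_def M_def by (simp add: algebra_simps)
  obtain q where q: "p = Suc (Suc q)" using p by (metis add_2_eq_Suc le_Suc_ex)
  have "H = T - (1 - fps_X) * (T * E) * E ^ (p - 1)"
    unfolding H_def residual_fps_def E_def[symmetric] unfolding T_def[symmetric] by (simp add: q algebra_simps)
  then have H: "H = T - (1 - fps_X) * E ^ Suc q" unfolding TE by (simp add: q)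
  have "fps_deriv H = fps_deriv T + E ^ Suc q - (1 - fps_X) * (of_nat (Suc q) * fps_deriv E * E ^ q)"
    using fps_deriv_power'[of E "Suc q"] unfolding H
    by (simp only: fps_deriv_sub fps_deriv_mult fps_deriv_1 fps_deriv_fps_X diff_Suc_1) simp
  also have "\<dots> = fps_deriv T + E ^ Suc q + (1 - fps_X) * of_nat (Suc q) * fps_deriv T * E ^ p"
    unfolding dE by (simp add: q algebra_simps power2_eq_square del: of_nat_Suc)
  finally have "of_nat p * fps_deriv H
      = of_nat p * (fps_deriv T + E ^ Suc q + (1 - fps_X) * of_nat (Suc q) * fps_deriv T * E ^ p)"
    by (rule arg_cong)
  also have "\<dots> = of_nat p * fps_deriv T + of_nat p * E ^ Suc q
      + of_nat (Suc q) * E ^ p * (of_nat p * (1 - fps_X) * fps_deriv T)"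
    by (simp only: algebra_simps)
  also have "\<dots> = of_nat p * fps_deriv T + of_nat p * E ^ Suc q
      + of_nat (Suc q) * E ^ p * M - of_nat (Suc q) * (T * E) * E ^ Suc q"
    unfolding ode unfolding q by (simp only: power_Suc algebra_simps)
  \<comment> \<open>Once \<open>T * E = 1\<close>, the last term cancels all but one of the
    \<open>p\<close> copies of \<open>E ^ Suc q\<close>.\<close>
  also have "\<dots> = of_nat p * fps_deriv T + (E ^ Suc q + of_nat (Suc q) * E ^ p * M)"
    unfolding TE unfolding q by (simp only: of_nat_Suc[of "Suc q"] mult_1_left mult_1_right algebra_simps)
  finally have dH: "of_nat p * fps_deriv H
      = of_nat p * fps_deriv T + (E ^ Suc q + fps_const (real (Suc q)) * E ^ p * M)"
    by (simp only: fps_of_nat)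
  have rest: "fps_nonneg (E ^ Suc q + fps_const (real (Suc q)) * E ^ p * M)"
    using ode_const_nonneg schroeder_fps_nonneg_inverse unfolding M_def E_def
    by (intro fps_nonneg_add fps_nonneg_mult fps_nonneg_power fps_nonneg_const fps_nonneg_X) auto
  have "0 \<le> fps_nth H n" for n
  proof (cases "n \<le> m")
    case False
    then obtain i where i: "n = Suc i" "i \<ge> m" by (metis not_less_eq_eq Suc_le_D)
    then have "fps_nth T (Suc i) = 0" by (simp add: T_def schroeder_fps_def)
    then have "0 \<le> fps_nth (of_nat p * fps_deriv H) i"
      unfolding dH using fps_nonnegD[OF rest, of i] by (simp add: fps_mult_of_nat_nth)
    then show ?thesis using p i by (simp add: fps_mult_of_nat_nth zero_le_mult_iff)
  qed (simp add: low)
  then show ?thesis by (simp add: fps_nonneg_def H_def)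
qed

section \<open>The iterates and their residuals as power series\<close>

primrec resid_series :: "nat \<Rightarrow> real fps" where
  "resid_series 0 = fps_X"
| "resid_series (Suc k) = ff oo resid_series k"

text \<open>The residual has a recursion of its own, so no inverse of an iterate enters the
  definition; \<open>resid_series_eq\<close> identifies it with
  \<open>1 - (1 - t) x^(-p)\<close>.\<close>

primrec iter_series :: "nat \<Rightarrow> real fps" where
  "iter_series 0 = 1"
| "iter_series (Suc k) = iter_series k * (TT oo resid_series k)"

lemma resid_series_nth_0 [simp]: "fps_nth (resid_series k) 0 = 0"
  by (cases k) (simp_all add: residual_fps_nth_low)

lemma resid_series_nonneg: "fps_nonneg (resid_series k)"
  by (induction k) (simp_all add: fps_nonneg_compose residual_fps_nonneg)

lemma iter_series_nth_0 [simp]: "fps_nth (iter_series k) 0 = 1"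
  by (induction k) simp_all

text \<open>One step gives \<open>x' r' = x * ((T f) oo r)\<close>, and \<open>T f\<close> is
  nonnegative without constant term. The product is propagated because the iterate alone has
  nonpositive coefficients beyond degree 0.\<close>

lemma iter_series_mult_resid_nonneg: "fps_nonneg (iter_series k * resid_series k)"
proof (induction k)
  case (Suc k)
  have "iter_series (Suc k) * resid_series (Suc k) = iter_series k * ((TT * ff) oo resid_series k)"
    by (simp only: resid_series.simps iter_series.simps fps_compose_mult_distrib[OF resid_series_nth_0] mult.assoc)
  then show ?case
    using fps_nonneg_mult_compose[OF Suc resid_series_nonneg _ schroeder_mult_residual_fps_nonneg]
    by (simp only: resid_series_nth_0 fps_mult_nth_0 residual_fps_nth_low le0 mult_zero_right)
qed simp

lemma iter_series_decreasing: "fps_nonneg (iter_series k - iter_series (Suc k))"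
proof -
  have "iter_series k - iter_series (Suc k) = iter_series k * ((1 - TT) oo resid_series k)"
    by (simp add: fps_compose_sub_distrib algebra_simps)
  then show ?thesis
    using fps_nonneg_mult_compose[OF iter_series_mult_resid_nonneg resid_series_nonneg _
        one_minus_schroeder_fps_nonneg] by simp
qed

text \<open>The identity \<open>T^p (1 - f) = 1 - t\<close>, composed with the residual, carries the
  invariant to the next step.\<close>

lemma iter_series_power: "iter_series k ^ p * (1 - resid_series k) = 1 - fps_X"
proof (induction k)
  case (Suc k)
  have "(TT * EE) ^ p = 1" unfolding schroeder_fps_mult_inverse by simp
  then have "TT ^ p * (1 - ff) = 1 - fps_X"
    unfolding residual_fps_def by (simp add: power_mult_distrib algebra_simps)
  moreover have "(TT ^ p * (1 - ff)) oo resid_series k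
      = (TT oo resid_series k) ^ p * (1 - resid_series (Suc k))"
    by (simp add: fps_compose_mult_distrib fps_compose_power fps_compose_sub_distrib)
  ultimately have "(TT oo resid_series k) ^ p * (1 - resid_series (Suc k)) = 1 - resid_series k"
    by (simp add: fps_compose_sub_distrib fps_X_fps_compose_startby0)
  then show ?case using Suc by (simp add: power_mult_distrib mult.assoc)
qed simp

text \<open>As \<open>m >= 1\<close>, the residual map is divisible by \<open>t^2\<close>, so each
  residual contains the square of the previous one and its order of vanishing grows.\<close>

lemma resid_series_nth_low: "n \<le> k \<Longrightarrow> fps_nth (resid_series k) n = 0"
proof (induction k arbitrary: n)
  case (Suc k)
  define g where "g = fps_shift 1 (fps_shift 1 ff)"
  have z: "fps_nth ff 0 = 0" "fps_nth (fps_shift 1 ff) 0 = 0"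
    using residual_fps_nth_low m by auto
  have "resid_series (Suc k) = resid_series k * (resid_series k * (g oo resid_series k))"
    using fps_compose_zero_nth[OF z(1) resid_series_nth_0] fps_compose_zero_nth[OF z(2) resid_series_nth_0]
    by (simp add: g_def)
  moreover have "fps_nth (resid_series k * (resid_series k * (g oo resid_series k))) n = 0"
    unfolding fps_mult_nth[of "resid_series k"]
  proof (rule sum.neutral, rule ballI)
    fix i assume "i \<in> {0..n}"
    \<comment> \<open>For \<open>i > k\<close> the bound \<open>n <= k + 1\<close> forces
      \<open>i = n\<close>; the inner sum then reduces to a multiple of the constant term of the
      residual, which is 0.\<close>
    then show "fps_nth (resid_series k) i
        * (\<Sum>j = 0..n - i. fps_nth (resid_series k) j * fps_nth (g oo resid_series k) (n - i - j)) = 0"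
      using Suc by (cases "i \<le> k") auto
  qed
  ultimately show ?case by simp
qed simp

text \<open>Both sides are \<open>p\<close>-th roots of \<open>1 - t\<close> with constant term 1,
  and such a root is unique.\<close>

lemma iter_series_root_fps: "iter_series k * (root_fps p oo resid_series k) = root_fps p"
proof (rule fps_power_eqD)
  have "root_fps p ^ p oo resid_series k = 1 - resid_series k"
    using p by (simp add: root_fps_power fps_compose_sub_distrib fps_X_fps_compose_startby0)
  then show "(iter_series k * (root_fps p oo resid_series k)) ^ p = root_fps p ^ p"
    using iter_series_power[of k] p
    by (simp only: power_mult_distrib fps_compose_power[OF resid_series_nth_0] root_fps_power)
  show "fps_nth (iter_series k * (root_fps p oo resid_series k)) 0 = fps_nth (root_fps p) 0"
    and "fps_nth (iter_series k * (root_fps p oo resid_series k)) 0 \<noteq> 0"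
    by (simp_all add: root_fps_def)
  show "p > 0" using p by simp
qed

text \<open>The root series composed with the residual agrees with 1 up to degree \<open>k\<close>,
  because the residual vanishes there.\<close>

lemma iter_series_nth_low:
  assumes "n \<le> k"
  shows "fps_nth (iter_series k) n = root_coeff p n"
proof -
  define V where "V = root_fps p oo resid_series k"
  have V0: "fps_nth V 0 = 1" by (simp add: V_def root_fps_def)
  have "fps_nth (1 - root_fps p) 0 = 0" by (simp add: root_fps_def)
  from fps_compose_zero_nth[OF this resid_series_nth_0, of k]
  have "1 - V = resid_series k * (fps_shift 1 (1 - root_fps p) oo resid_series k)"
    unfolding V_def by (simp only: fps_compose_sub_distrib fps_compose_1)
  then have "fps_nth (1 - V) i = 0" if "i \<le> k" for i
    using that by (simp only: fps_mult_nth) (intro sum.neutral, simp add: resid_series_nth_low)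
  then have V: "fps_nth V i = 0" if "i \<le> k" "i > 0" for i using that by force
  have "root_coeff p n = fps_nth (iter_series k * V) n"
    unfolding V_def iter_series_root_fps by (simp add: root_fps_def)
  also have "\<dots> = (\<Sum>i=0..n. if i = n then fps_nth (iter_series k) n else 0)"
    unfolding fps_mult_nth using assms V V0 by (intro sum.cong) auto
  finally show ?thesis by simp
qed

lemma iter_series_antimono:
  assumes "k \<le> l"
  shows "fps_nth (iter_series l) n \<le> fps_nth (iter_series k) n"
  using assms
proof (induction l rule: dec_induct)
  case (step l)
  then show ?case using fps_nonnegD[OF iter_series_decreasing[of l], of n] by simp
qed simp

text \<open>The coefficients decrease in \<open>k\<close>, from those of \<open>x_0 = 1\<close> down
  to the root coefficient, which is reached at index \<open>max k n\<close>.\<close>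

lemma iter_series_abs_le: "\<bar>fps_nth (iter_series k) n\<bar> \<le> 1"
proof (cases "n = 0")
  case False
  have "fps_nth (iter_series k) n \<le> fps_nth (iter_series 0) n" by (intro iter_series_antimono) simp
  moreover have "root_coeff p n \<le> fps_nth (iter_series k) n"
    using iter_series_antimono[of k "max k n" n] iter_series_nth_low[of n "max k n"] by simp
  moreover have "-1 \<le> root_coeff p n" using root_coeff_bounds[of p n] p False by simp
  ultimately show ?thesis using False by simp
qed simp

lemma inverse_iter_series_nonneg: "fps_nonneg (inverse (iter_series k))"
proof (rule fps_nonneg_inverse)
  fix n :: nat assume "n > 0"
  then show "fps_nth (iter_series k) n \<le> 0"
    using iter_series_antimono[of 0 k n] by simp
qed simp

lemma iter_series_mult_inverse: "iter_series k * inverse (iter_series k) = 1"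
  by (rule inverse_mult_eq_1') simp

lemma resid_series_eq: "resid_series k = 1 - (1 - fps_X) * inverse (iter_series k) ^ p"
proof -
  have "(1 - fps_X) * inverse (iter_series k) ^ p
      = (iter_series k * inverse (iter_series k)) ^ p * (1 - resid_series k)"
    unfolding iter_series_power[of k, symmetric] power_mult_distrib
    by (simp only: mult.assoc mult.left_commute mult.commute)
  then show ?thesis by (simp add: iter_series_mult_inverse)
qed

text \<open>Multiplying by \<open>1 / (1 - t)\<close> takes partial sums, so the relation between \<open>r\<close> and \<open>x\<^sup>-\<^sup>p\<close>
  bounds the coefficients of both series by 1.\<close>

lemma inverse_iter_series_power_nth:
  "fps_nth (inverse (iter_series k) ^ p) n = 1 - (\<Sum>i\<le>n. fps_nth (resid_series k) i)"
proof -
  have "(1 - fps_X) * inverse (1 - fps_X :: real fps) = 1"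
    by (rule inverse_mult_eq_1') simp
  then have "inverse (iter_series k) ^ p = (1 - resid_series k) * inverse (1 - fps_X)"
    unfolding resid_series_eq[of k] by (simp add: mult.assoc mult.left_commute mult.commute)
  also have "fps_nth \<dots> n = (\<Sum>i=0..n. fps_nth (1 - resid_series k) i)"
    by (simp add: fps_inverse_one_minus_fps_X fps_mult_nth)
  also have "\<dots> = 1 - (\<Sum>i\<le>n. fps_nth (resid_series k) i)"
    by (simp add: sum_subtractf atLeast0AtMost)
  finally show ?thesis .
qed

lemma resid_series_abs_le: "\<bar>fps_nth (resid_series k) n\<bar> \<le> 1"
proof -
  have "0 \<le> fps_nth (inverse (iter_series k) ^ p) n"
    by (intro fps_nonnegD fps_nonneg_power inverse_iter_series_nonneg)
  moreover have "fps_nth (resid_series k) n \<le> (\<Sum>i\<le>n. fps_nth (resid_series k) i)"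
    by (rule member_le_sum) (auto intro: fps_nonnegD resid_series_nonneg)
  ultimately show ?thesis
    using fps_nonnegD[OF resid_series_nonneg, of k n] by (simp add: inverse_iter_series_power_nth)
qed

text \<open>As \<open>?Y ^ (p - 1)\<close> is nonnegative with constant term 1, each coefficient of
  \<open>?Y\<close> is at most the same coefficient of \<open>?Y ^ p\<close>, which is bounded by
  1.\<close>

lemma inverse_iter_series_abs_le: "\<bar>fps_nth (inverse (iter_series k)) n\<bar> \<le> 1"
proof -
  let ?Y = "inverse (iter_series k)"
  have Y: "fps_nonneg ?Y" by (rule inverse_iter_series_nonneg)
  have "fps_nth ?Y n = fps_nth ?Y n * fps_nth (?Y ^ (p - 1)) (n - n)"
    by (simp add: fps_power_zeroth)
  also have "\<dots> \<le> (\<Sum>i=0..n. fps_nth ?Y i * fps_nth (?Y ^ (p - 1)) (n - i))"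
    by (rule member_le_sum[of n "{0..n}" "\<lambda>i. fps_nth ?Y i * fps_nth (?Y ^ (p - 1)) (n - i)"])
      (auto intro!: mult_nonneg_nonneg fps_nonnegD[OF Y] fps_nonnegD[OF fps_nonneg_power[OF Y]])
  also have "\<dots> = fps_nth (?Y ^ p) n"
    using p power_minus_mult[of p ?Y] by (simp only: mult.commute flip: fps_mult_nth)
  also have "\<dots> \<le> 1"
    unfolding inverse_iter_series_power_nth
    by (simp add: sum_nonneg fps_nonnegD[OF resid_series_nonneg])
  finally show ?thesis using fps_nonnegD[OF Y, of n] by simp
qed

end

section \<open>Evaluation of power series at a matrix\<close>

lemma pow_mat_add:
  assumes "(A::'a::semiring_1 mat) \<in> carrier_mat n n"
  shows "A ^\<^sub>m (k + l) = A ^\<^sub>m k * A ^\<^sub>m l"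
proof (induction l)
  case 0
  then show ?case using assms right_mult_one_mat[of "A ^\<^sub>m k" n n] by simp
next
  case (Suc l)
  then show ?case
    using assms by (simp add: assoc_mult_mat[of "A ^\<^sub>m k" n n "A ^\<^sub>m l" n A n])
qed

lemma index_mult_mat_sum:
  assumes "A \<in> carrier_mat n n" and "C \<in> carrier_mat n n" and "i < n" and "j < n"
  shows "(A * C) $$ (i, j) = (\<Sum>k<n. A $$ (i, k) * C $$ (k, j))"
  using assms by (simp add: scalar_prod_def atLeast0LessThan)

lemma index_mult_mat_vec_sum:
  assumes "A \<in> carrier_mat n n" and "w \<in> carrier_vec n" and "i < n"
  shows "vec_index (A *\<^sub>v w) i = (\<Sum>k<n. A $$ (i, k) * vec_index w k)"
  using assms by (simp add: scalar_prod_def atLeast0LessThan)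

lemma pow_mat_nonneg:
  fixes A :: "'a::linordered_semidom mat"
  assumes A: "A \<in> carrier_mat n n" and "\<And>i j. i < n \<Longrightarrow> j < n \<Longrightarrow> 0 \<le> A $$ (i, j)"
    and "i < n" and "j < n"
  shows "0 \<le> (A ^\<^sub>m l) $$ (i, j)"
  using assms(3,4)
proof (induction l arbitrary: i j)
  case 0
  then show ?case using A by simp
next
  case (Suc l)
  have "(A ^\<^sub>m Suc l) $$ (i, j) = (\<Sum>k<n. (A ^\<^sub>m l) $$ (i, k) * A $$ (k, j))"
    using index_mult_mat_sum[of "A ^\<^sub>m l" n A i j] A Suc by simp
  also have "\<dots> \<ge> 0" using Suc assms(2) by (intro sum_nonneg) simp
  finally show ?case .
qed

section \<open>Convergent power series in a nonnegative matrix\<close>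

locale summable_mat =
  fixes n :: nat and B :: "real mat"
  assumes carrier: "B \<in> carrier_mat n n"
    and nonneg: "\<And>i j. i < n \<Longrightarrow> j < n \<Longrightarrow> 0 \<le> B $$ (i, j)"
    and summable_pow: "\<And>i j. i < n \<Longrightarrow> j < n \<Longrightarrow> summable (\<lambda>l. (B ^\<^sub>m l) $$ (i, j))"
begin

lemma pow_nonneg: "i < n \<Longrightarrow> j < n \<Longrightarrow> 0 \<le> (B ^\<^sub>m l) $$ (i, j)"
  using carrier nonneg by (rule pow_mat_nonneg)

lemma pow_index_split:
  assumes "i < n" and "j < n" and "a \<le> l"
  shows "(\<Sum>k<n. (B ^\<^sub>m a) $$ (i, k) * (B ^\<^sub>m (l - a)) $$ (k, j)) = (B ^\<^sub>m l) $$ (i, j)"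
  using assms carrier pow_mat_add[OF carrier, of a "l - a"]
    index_mult_mat_sum[of "B ^\<^sub>m a" n "B ^\<^sub>m (l - a)" i j] by simp

definition conv :: "real fps \<Rightarrow> bool" where
  "conv F \<longleftrightarrow> (\<forall>i<n. \<forall>j<n. summable (\<lambda>l. \<bar>fps_nth F l\<bar> * (B ^\<^sub>m l) $$ (i, j)))"

definition fps_eval :: "real fps \<Rightarrow> real mat" where
  "fps_eval F = mat n n (\<lambda>(i, j). \<Sum>l. fps_nth F l * (B ^\<^sub>m l) $$ (i, j))"

lemma fps_eval_carrier [simp]: "fps_eval F \<in> carrier_mat n n"
  by (simp add: fps_eval_def)

lemma fps_eval_dim [simp]: "dim_row (fps_eval F) = n" "dim_col (fps_eval F) = n"
  by (simp_all add: fps_eval_def)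

lemma fps_eval_index:
  "i < n \<Longrightarrow> j < n \<Longrightarrow> fps_eval F $$ (i, j) = (\<Sum>l. fps_nth F l * (B ^\<^sub>m l) $$ (i, j))"
  by (simp add: fps_eval_def)

lemma conv_norm_summable:
  "conv F \<Longrightarrow> i < n \<Longrightarrow> j < n \<Longrightarrow> summable (\<lambda>l. norm (fps_nth F l * (B ^\<^sub>m l) $$ (i, j)))"
  by (simp add: conv_def abs_mult pow_nonneg)

lemma conv_summable:
  "conv F \<Longrightarrow> i < n \<Longrightarrow> j < n \<Longrightarrow> summable (\<lambda>l. fps_nth F l * (B ^\<^sub>m l) $$ (i, j))"
  by (rule summable_norm_cancel) (rule conv_norm_summable)

lemma conv_bounded:
  assumes "\<And>l. \<bar>fps_nth F l\<bar> \<le> 1"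
  shows "conv F"
  unfolding conv_def
proof (intro allI impI)
  fix i j assume ij: "i < n" "j < n"
  show "summable (\<lambda>l. \<bar>fps_nth F l\<bar> * (B ^\<^sub>m l) $$ (i, j))"
    by (rule summable_comparison_test'[OF summable_pow[OF ij], of 0])
      (use assms pow_nonneg[OF ij] in \<open>simp add: abs_mult mult_left_le_one_le\<close>)
qed

lemma conv_one: "conv 1" and conv_X: "conv fps_X"
  by (intro conv_bounded; simp add: fps_X_def)+

lemma conv_diff:
  assumes "conv F" and "conv G"
  shows "conv (F - G)"
  unfolding conv_def
proof (intro allI impI)
  fix i j assume ij: "i < n" "j < n"
  have "summable (\<lambda>l. \<bar>fps_nth F l\<bar> * (B ^\<^sub>m l) $$ (i, j) + \<bar>fps_nth G l\<bar> * (B ^\<^sub>m l) $$ (i, j))"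
    using assms ij by (intro summable_add) (simp_all add: conv_def)
  then show "summable (\<lambda>l. \<bar>fps_nth (F - G) l\<bar> * (B ^\<^sub>m l) $$ (i, j))"
    by (rule summable_comparison_test'[of _ 0])
      (simp add: abs_mult pow_nonneg[OF ij] abs_triangle_ineq4 mult_right_mono flip: distrib_right)
qed

lemma fps_eval_diff:
  assumes "conv F" and "conv G"
  shows "fps_eval (F - G) = fps_eval F - fps_eval G"
  by (rule eq_matI)
    (use assms in \<open>simp_all add: fps_eval_index left_diff_distrib conv_summable suminf_diff\<close>)

lemma fps_eval_one: "fps_eval 1 = 1\<^sub>m n"
proof (rule eq_matI)
  fix i j assume "i < dim_row (1\<^sub>m n :: real mat)" "j < dim_col (1\<^sub>m n :: real mat)"
  moreover have "(\<lambda>l. fps_nth 1 l * (B ^\<^sub>m l) $$ (i, j)) = (\<lambda>l. if l = 0 then (B ^\<^sub>m l) $$ (i, j) else 0)"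
    by auto
  ultimately show "fps_eval 1 $$ (i, j) = 1\<^sub>m n $$ (i, j)"
    using carrier sums_unique[OF sums_single[of 0 "\<lambda>l. (B ^\<^sub>m l) $$ (i, j)"]]
    by (simp add: fps_eval_index)
qed simp_all

lemma fps_eval_X: "fps_eval fps_X = B"
proof (rule eq_matI)
  fix i j assume "i < dim_row B" "j < dim_col B"
  moreover have "(\<lambda>l. fps_nth fps_X l * (B ^\<^sub>m l) $$ (i, j)) = (\<lambda>l. if l = 1 then (B ^\<^sub>m l) $$ (i, j) else 0)"
    by (auto simp: fps_X_def)
  ultimately show "fps_eval fps_X $$ (i, j) = B $$ (i, j)"
    using carrier sums_unique[OF sums_single[of 1 "\<lambda>l. (B ^\<^sub>m l) $$ (i, j)"]]
    by (simp add: fps_eval_index)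
qed (use carrier in simp_all)

text \<open>An entry of the product is a finite sum of Cauchy products; in each degree
  \<open>l\<close> the sum over the inner index merges \<open>B^a\<close> and \<open>B^(l-a)\<close>
  into \<open>B^l\<close>.\<close>

lemma
  assumes "conv F" and "conv G"
  shows conv_mult: "conv (F * G)" and fps_eval_mult: "fps_eval (F * G) = fps_eval F * fps_eval G"
proof -
  have split: "(\<Sum>k<n. \<Sum>a\<le>l. (u a * (B ^\<^sub>m a) $$ (i, k)) * (v (l - a) * (B ^\<^sub>m (l - a)) $$ (k, j)))
      = (\<Sum>a\<le>l. u a * v (l - a)) * (B ^\<^sub>m l) $$ (i, j)" if "i < n" "j < n" for i j l u v
  proof -
    have "(\<Sum>k<n. \<Sum>a\<le>l. (u a * (B ^\<^sub>m a) $$ (i, k)) * (v (l - a) * (B ^\<^sub>m (l - a)) $$ (k, j)))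
      = (\<Sum>a\<le>l. u a * v (l - a) * (\<Sum>k<n. (B ^\<^sub>m a) $$ (i, k) * (B ^\<^sub>m (l - a)) $$ (k, j)))"
      by (subst sum.swap) (simp add: sum_distrib_left mult_ac)
    also have "\<dots> = (\<Sum>a\<le>l. u a * v (l - a) * (B ^\<^sub>m l) $$ (i, j))"
      using that by (intro sum.cong) (simp_all add: pow_index_split)
    finally show ?thesis by (simp add: sum_distrib_right)
  qed
  show "conv (F * G)"
    unfolding conv_def
  proof (intro allI impI)
    fix i j assume ij: "i < n" "j < n"
    have "summable (\<lambda>l. \<Sum>k<n. \<Sum>a\<le>l. (\<bar>fps_nth F a\<bar> * (B ^\<^sub>m a) $$ (i, k))
        * (\<bar>fps_nth G (l - a)\<bar> * (B ^\<^sub>m (l - a)) $$ (k, j)))"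
      using conv_norm_summable[OF assms(1)] conv_norm_summable[OF assms(2)] ij
      by (intro summable_sum summable_Cauchy_product) (simp_all add: abs_mult pow_nonneg)
    then have "summable (\<lambda>l. (\<Sum>a\<le>l. \<bar>fps_nth F a\<bar> * \<bar>fps_nth G (l - a)\<bar>) * (B ^\<^sub>m l) $$ (i, j))"
      by (simp only: split[OF ij, where u = "\<lambda>a. \<bar>fps_nth F a\<bar>" and v = "\<lambda>a. \<bar>fps_nth G a\<bar>"])
    then show "summable (\<lambda>l. \<bar>fps_nth (F * G) l\<bar> * (B ^\<^sub>m l) $$ (i, j))"
    proof (rule summable_comparison_test'[of _ 0])
      fix l
      have "\<bar>fps_nth (F * G) l\<bar> \<le> (\<Sum>a\<le>l. \<bar>fps_nth F a\<bar> * \<bar>fps_nth G (l - a)\<bar>)"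
        unfolding fps_mult_nth atLeast0AtMost
        by (rule order.trans[OF sum_abs]) (simp add: abs_mult)
      then show "norm (\<bar>fps_nth (F * G) l\<bar> * (B ^\<^sub>m l) $$ (i, j))
          \<le> (\<Sum>a\<le>l. \<bar>fps_nth F a\<bar> * \<bar>fps_nth G (l - a)\<bar>) * (B ^\<^sub>m l) $$ (i, j)"
        by (simp add: abs_mult pow_nonneg[OF ij] mult_right_mono)
    qed
  qed
  show "fps_eval (F * G) = fps_eval F * fps_eval G"
  proof (rule eq_matI)
    fix i j assume "i < dim_row (fps_eval F * fps_eval G)" "j < dim_col (fps_eval F * fps_eval G)"
    then have ij: "i < n" "j < n" by simp_all
    have "(fps_eval F * fps_eval G) $$ (i, j)
        = (\<Sum>k<n. (\<Sum>l. fps_nth F l * (B ^\<^sub>m l) $$ (i, k)) * (\<Sum>l. fps_nth G l * (B ^\<^sub>m l) $$ (k, j)))"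
      using ij by (simp add: index_mult_mat_sum[where n = n] fps_eval_index del: index_mult_mat)
    also have "\<dots> = (\<Sum>k<n. \<Sum>l. \<Sum>a\<le>l. (fps_nth F a * (B ^\<^sub>m a) $$ (i, k))
        * (fps_nth G (l - a) * (B ^\<^sub>m (l - a)) $$ (k, j)))"
      using ij assms by (intro sum.cong refl Cauchy_product conv_norm_summable) simp_all
    also have "\<dots> = (\<Sum>l. \<Sum>k<n. \<Sum>a\<le>l. (fps_nth F a * (B ^\<^sub>m a) $$ (i, k))
        * (fps_nth G (l - a) * (B ^\<^sub>m (l - a)) $$ (k, j)))"
      using ij assms
      by (intro suminf_sum[symmetric] summable_Cauchy_product conv_norm_summable) simp_all
    also have "\<dots> = fps_eval (F * G) $$ (i, j)"
      using ij by (simp only: split) (simp add: fps_eval_index fps_mult_nth atLeast0AtMost)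
    finally show "fps_eval (F * G) $$ (i, j) = (fps_eval F * fps_eval G) $$ (i, j)" by simp
  qed simp_all
qed

lemma
  assumes "conv F"
  shows conv_power: "conv (F ^ k)" and fps_eval_power: "fps_eval (F ^ k) = fps_eval F ^\<^sub>m k"
proof -
  have "conv (F ^ k) \<and> fps_eval (F ^ k) = fps_eval F ^\<^sub>m k"
    using assms by (induction k) (simp_all add: conv_one conv_mult fps_eval_one fps_eval_mult
        power_Suc2 del: power_Suc)
  then show "conv (F ^ k)" "fps_eval (F ^ k) = fps_eval F ^\<^sub>m k" by auto
qed

lemma fps_eval_mono:
  assumes "conv F" and "conv G" and "fps_nonneg (G - F)"
  shows "fps_eval F \<le> fps_eval G"
  unfolding less_eq_mat_def
proof (intro conjI allI impI)
  fix i j assume "i < dim_row (fps_eval G)" "j < dim_col (fps_eval G)"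
  then have ij: "i < n" "j < n" by simp_all
  then show "fps_eval F $$ (i, j) \<le> fps_eval G $$ (i, j)"
    using assms fps_nonnegD[OF assms(3)]
    by (simp add: fps_eval_index) (intro suminf_le mult_right_mono; simp add: conv_summable pow_nonneg)
qed simp_all

lemma T_mat_fps_eval:
  assumes "conv F" and "fps_nth F 0 = 0"
  shows "conv (schroeder_fps p m oo F)"
    and "fps_eval (schroeder_fps p m oo F) = T_mat p m (fps_eval F)"
proof -
  define b where "b = root_coeff p"
  have "fps_nth (schroeder_fps p m oo F) l = (\<Sum>a\<le>m. b a * fps_nth (F ^ a) l)" for l
  proof -
    \<comment> \<open>The composition sums over \<open>a <= l\<close>, the polynomial over
      \<open>a <= m\<close>. Both sums agree because \<open>F\<close> has no constant term, so
      \<open>F ^ a\<close> has no terms below degree \<open>a\<close>.\<close>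
    have "fps_nth (F ^ a) l = 0" if "l < a" for a
      using that assms(2) by (simp add: startsby_zero_power_prefix)
    then have "(\<Sum>a\<le>m. b a * fps_nth (F ^ a) l) = (\<Sum>a\<in>{..m} \<inter> {0..l}. b a * fps_nth (F ^ a) l)"
      by (intro sum.mono_neutral_right) auto
    also have "\<dots> = (\<Sum>a\<in>{0..l}. (if a \<le> m then b a else 0) * fps_nth (F ^ a) l)"
      by (intro sum.mono_neutral_cong_left) auto
    finally show ?thesis unfolding fps_compose_nth schroeder_fps_def b_def by simp
  qed
  note nth = this
  have conv: "conv (F ^ a)" for a using assms(1) by (rule conv_power)
  show "conv (schroeder_fps p m oo F)"
    unfolding conv_def
  proof (intro allI impI)
    fix i j assume ij: "i < n" "j < n"
    have "summable (\<lambda>l. \<Sum>a\<le>m. \<bar>b a\<bar> * (\<bar>fps_nth (F ^ a) l\<bar> * (B ^\<^sub>m l) $$ (i, j)))"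
      using conv ij by (intro summable_sum summable_mult) (simp add: conv_def)
    then show "summable (\<lambda>l. \<bar>fps_nth (schroeder_fps p m oo F) l\<bar> * (B ^\<^sub>m l) $$ (i, j))"
    proof (rule summable_comparison_test'[of _ 0])
      fix l
      have "\<bar>fps_nth (schroeder_fps p m oo F) l\<bar> \<le> (\<Sum>a\<le>m. \<bar>b a\<bar> * \<bar>fps_nth (F ^ a) l\<bar>)"
        unfolding nth by (rule order.trans[OF sum_abs]) (simp add: abs_mult)
      then show "norm (\<bar>fps_nth (schroeder_fps p m oo F) l\<bar> * (B ^\<^sub>m l) $$ (i, j))
          \<le> (\<Sum>a\<le>m. \<bar>b a\<bar> * (\<bar>fps_nth (F ^ a) l\<bar> * (B ^\<^sub>m l) $$ (i, j)))"
        by (simp add: abs_mult pow_nonneg[OF ij] mult_right_mono flip: sum_distrib_right mult.assoc)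
    qed
  qed
  show "fps_eval (schroeder_fps p m oo F) = T_mat p m (fps_eval F)"
  proof (rule eq_matI)
    fix i j assume "i < dim_row (T_mat p m (fps_eval F))" "j < dim_col (T_mat p m (fps_eval F))"
    then have ij: "i < n" "j < n" by (simp_all add: T_mat_def)
    have "fps_eval (schroeder_fps p m oo F) $$ (i, j)
        = (\<Sum>l. \<Sum>a\<le>m. b a * (fps_nth (F ^ a) l * (B ^\<^sub>m l) $$ (i, j)))"
      using ij by (simp add: fps_eval_index nth sum_distrib_right mult.assoc)
    also have "\<dots> = (\<Sum>a\<le>m. \<Sum>l. b a * (fps_nth (F ^ a) l * (B ^\<^sub>m l) $$ (i, j)))"
      using ij conv by (intro suminf_sum summable_mult conv_summable)
    also have "\<dots> = (\<Sum>a\<le>m. b a * (fps_eval F ^\<^sub>m a) $$ (i, j))"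
      using ij conv assms(1)
      by (simp add: suminf_mult conv_summable fps_eval_index flip: fps_eval_power)
    finally show "fps_eval (schroeder_fps p m oo F) $$ (i, j) = T_mat p m (fps_eval F) $$ (i, j)"
      using ij by (simp add: T_mat_def b_def)
  qed (simp_all add: T_mat_def)
qed

text \<open>Each coefficient is eventually constant in \<open>k\<close>, and the entries of the
  powers of \<open>B\<close> dominate all terms, so Tannery's theorem exchanges limit and
  sum.\<close>

lemma fps_eval_tendsto:
  assumes "\<And>k l. \<bar>fps_nth (F k) l\<bar> \<le> 1" and "\<And>k l. l \<le> k \<Longrightarrow> fps_nth (F k) l = fps_nth G l"
    and "i < n" and "j < n"
  shows "(\<lambda>k. fps_eval (F k) $$ (i, j)) \<longlonglongrightarrow> fps_eval G $$ (i, j)"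
proof -
  let ?b = "\<lambda>l. (B ^\<^sub>m l) $$ (i, j)"
  have "(\<lambda>k. \<Sum>l. fps_nth (F k) l * ?b l) \<longlonglongrightarrow> (\<Sum>l. fps_nth G l * ?b l)"
  proof (rule tannerys_theorem[THEN conjunct2, THEN conjunct2])
    fix l
    have "eventually (\<lambda>k. fps_nth G l * ?b l = fps_nth (F k) l * ?b l) sequentially"
      using assms(2)[of l] by (auto simp: eventually_sequentially intro!: exI[of _ l])
    then show "(\<lambda>k. fps_nth (F k) l * ?b l) \<longlonglongrightarrow> fps_nth G l * ?b l"
      by (rule Lim_transform_eventually[OF tendsto_const])
    show "eventually (\<lambda>(l, k). norm (fps_nth (F k) l * ?b l) \<le> ?b l) (at_top \<times>\<^sub>F sequentially)"
      using assms(1) pow_nonneg[OF assms(3,4)]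
      by (intro always_eventually) (auto simp: abs_mult mult_left_le_one_le)
  qed (use assms summable_pow in simp_all)
  then show ?thesis using assms(3,4) by (simp add: fps_eval_index)
qed

lemma inverse_mat_fps_eval:
  assumes "conv F" and "conv G" and "F * G = 1"
  shows "invertible_mat (fps_eval F)" and "the (mat_inverse (fps_eval F)) = fps_eval G"
proof -
  have FG: "fps_eval F * fps_eval G = 1\<^sub>m n" "fps_eval G * fps_eval F = 1\<^sub>m n"
    using assms fps_eval_one fps_eval_mult by (metis mult.commute)+
  then show inv: "invertible_mat (fps_eval F)"
    unfolding invertible_mat_def inverts_mat_def square_mat.simps by (auto intro!: exI[of _ "fps_eval G"])
  \<comment> \<open>Being a unit excludes the result \<open>None\<close>, so \<open>the\<close> is
    applied to an actual inverse.\<close>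
  have "fps_eval F \<in> Units (ring_mat TYPE(real) n ())"
    using FG unfolding Units_def ring_mat_def by auto
  then obtain C where C: "mat_inverse (fps_eval F) = Some C"
    using mat_inverse(1)[OF fps_eval_carrier, of F "()"] by fastforce
  from mat_inverse(2)[OF fps_eval_carrier C]
  have "C * fps_eval F = 1\<^sub>m n" "C \<in> carrier_mat n n" by auto
  then have "C = C * (fps_eval F * fps_eval G)" "fps_eval G = C * fps_eval F * fps_eval G"
    using FG by (simp_all add: left_mult_one_mat[of "fps_eval G" n n])
  then show "the (mat_inverse (fps_eval F)) = fps_eval G"
    using C \<open>C \<in> carrier_mat n n\<close> by (simp add: assoc_mult_mat[of C n n "fps_eval F" n "fps_eval G" n])
qed

text \<open>The coefficient bounds make the iterate, its inverse and the residual evaluable at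
  \<open>B\<close>; evaluation respects differences, products and powers, so it turns the recursion
  of series into that of matrices.\<close>

lemma schroeder_eq_fps_eval:
  assumes "p \<ge> 2" and "m \<ge> 1"
  shows "schroeder p m (1\<^sub>m n - B) k = fps_eval (iter_series p m k)"
proof (induction k)
  case 0
  then show ?case using carrier by (simp add: fps_eval_one iter_series.simps[OF assms])
next
  case (Suc k)
  let ?x = "iter_series p m k" and ?r = "resid_series p m k"
  have conv: "conv ?x" "conv ?r" "conv (inverse ?x)"
    using iter_series_abs_le[OF assms] resid_series_abs_le[OF assms] inverse_iter_series_abs_le[OF assms]
    by (auto intro: conv_bounded)
  have "fps_eval ?r = fps_eval (1 - (1 - fps_X) * inverse ?x ^ p)"
    by (subst resid_series_eq[OF assms]) simp
  also have "\<dots> = 1\<^sub>m n - (1\<^sub>m n - B) * fps_eval (inverse ?x) ^\<^sub>m p"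
    using conv by (simp add: fps_eval_diff fps_eval_mult fps_eval_power fps_eval_one fps_eval_X
        conv_diff conv_mult conv_power conv_one conv_X)
  finally have "residual p (1\<^sub>m n - B) (fps_eval ?x) = fps_eval ?r"
    using inverse_mat_fps_eval[OF conv(1,3) iter_series_mult_inverse[OF assms]] carrier
    by (simp add: residual_def)
  then show ?case
    using Suc conv T_mat_fps_eval[OF conv(2), of p m] resid_series_nth_0[OF assms]
    by (simp add: fps_eval_mult iter_series.simps[OF assms])
qed

end

section \<open>The principal root\<close>

lemma eigenvector_iff:
  "A \<in> carrier_mat n n \<Longrightarrow>
    eigenvector A u c \<longleftrightarrow> u \<in> carrier_vec n \<and> u \<noteq> 0\<^sub>v n \<and> A *\<^sub>v u = c \<cdot>\<^sub>v u"
  by (auto simp: eigenvector_def)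

text \<open>In a basis in which \<open>Y\<close> is upper triangular, applying
  \<open>Y - c I\<close> with a suitable diagonal entry \<open>c\<close> clears the last possibly
  nonzero coordinate of \<open>w\<close>. The vector stays in \<open>V\<close>, so the step at which
  it would become 0 exhibits an eigenvector in \<open>V\<close>.\<close>

lemma invariant_space_eigenvector:
  fixes Y :: "complex mat"
  assumes Y: "Y \<in> carrier_mat n n" and V: "V \<subseteq> carrier_vec n"
    and inv: "\<And>u c. u \<in> V \<Longrightarrow> Y *\<^sub>v u - c \<cdot>\<^sub>v u \<in> V"
    and w: "w \<in> V" "w \<noteq> 0\<^sub>v n"
  obtains u c where "u \<in> V" and "eigenvector Y u c"
proof -
  obtain es where "char_poly Y = (\<Prod>a\<leftarrow>es. [:- a, 1:])"
    using char_poly_factorized[OF Y] by blast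
  from schur_decomposition[OF Y this]
  obtain T P Q where sim: "similar_mat_wit Y T P Q" and ut: "upper_triangular T"
    by (metis prod_cases3)
  note PQ = similar_mat_witD2[OF Y sim]
  have QY: "Q * Y = T * Q"
  proof -
    have "Q * Y = Q * (P * (T * Q))"
      unfolding PQ(3) using PQ(5-7) by (simp add: assoc_mult_mat[of P n n T n Q n])
    also have "\<dots> = Q * P * (T * Q)" using PQ(5-7) by (simp add: assoc_mult_mat[of Q n n P n "T * Q" n])
    also have "\<dots> = T * Q" using PQ by (simp add: left_mult_one_mat[of "T * Q" n n])
    finally show ?thesis .
  qed
  have "\<exists>u c. u \<in> V \<and> eigenvector Y u c"
    if "k \<le> n" "w \<in> V" "w \<noteq> 0\<^sub>v n" "\<And>j. k \<le> j \<Longrightarrow> j < n \<Longrightarrow> vec_index (Q *\<^sub>v w) j = 0" for k w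
    using that
  proof (induction k arbitrary: w)
    case 0
    then have w: "w \<in> carrier_vec n" using V by auto
    have "Q *\<^sub>v w = 0\<^sub>v n" using 0 PQ by (intro eq_vecI) auto
    then have "P *\<^sub>v (Q *\<^sub>v w) = 0\<^sub>v n" using PQ(6) by (intro eq_vecI) auto
    then have "w = 0\<^sub>v n"
      using PQ w assoc_mult_mat_vec[OF PQ(6,7) w] by simp
    then show ?case using 0 by simp
  next
    case (Suc k)
    let ?c = "T $$ (k, k)"
    \<comment> \<open>Subtracting the diagonal entry clears coordinate \<open>k\<close>: by
      triangularity only later coordinates, which are already 0, could still contribute to
      it.\<close>
    define u where "u = Y *\<^sub>v w - ?c \<cdot>\<^sub>v w"
    have w: "w \<in> carrier_vec n" using Suc V by auto
    show ?case
    proof (cases "u = 0\<^sub>v n")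
      case True
      have "Y *\<^sub>v w = ?c \<cdot>\<^sub>v w"
      proof (rule eq_vecI)
        fix i assume "i < dim_vec (?c \<cdot>\<^sub>v w)"
        moreover from this have "vec_index u i = 0" using True w by simp
        ultimately show "vec_index (Y *\<^sub>v w) i = vec_index (?c \<cdot>\<^sub>v w) i"
          using w Y by (simp add: u_def)
      qed (use w Y in simp)
      then show ?thesis using Suc w Y by (auto simp: eigenvector_iff)
    next
      case False
      have z: "Q *\<^sub>v w \<in> carrier_vec n" using PQ(7) w by simp
      have "Q *\<^sub>v u = Q *\<^sub>v (Y *\<^sub>v w) - ?c \<cdot>\<^sub>v (Q *\<^sub>v w)"
        unfolding u_def using PQ(7) w Y
        by (simp add: mult_minus_distrib_mat_vec[of Q n n] mult_mat_vec[of Q n n])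
      also have "Q *\<^sub>v (Y *\<^sub>v w) = T *\<^sub>v (Q *\<^sub>v w)"
        using assoc_mult_mat_vec[OF PQ(7) Y w] assoc_mult_mat_vec[OF PQ(5,7) w] QY by simp
      finally have Qu: "Q *\<^sub>v u = T *\<^sub>v (Q *\<^sub>v w) - ?c \<cdot>\<^sub>v (Q *\<^sub>v w)" .
      have "vec_index (Q *\<^sub>v u) j = 0" if j: "k \<le> j" "j < n" for j
      proof -
        have "T $$ (j, l) * vec_index (Q *\<^sub>v w) l
            = (if l = j then T $$ (j, j) * vec_index (Q *\<^sub>v w) j else 0)" if l: "l < n" for l
        proof (cases "l < j")
          case True
          then have "T $$ (j, l) = 0" using upper_triangularD[OF ut, of l j] j PQ(5) by simp
          then show ?thesis using True by simp
        next
          case False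
          then show ?thesis using Suc.prems(4)[of l] j l by (cases "l = j") auto
        qed
        then have "vec_index (T *\<^sub>v (Q *\<^sub>v w)) j
            = (\<Sum>l<n. if l = j then T $$ (j, j) * vec_index (Q *\<^sub>v w) j else 0)"
          using index_mult_mat_vec_sum[OF PQ(5) z j(2)] by simp
        then have "vec_index (T *\<^sub>v (Q *\<^sub>v w)) j = T $$ (j, j) * vec_index (Q *\<^sub>v w) j"
          using j by simp
        moreover have "j = k \<or> vec_index (Q *\<^sub>v w) j = 0" using Suc.prems(4)[of j] j by linarith
        ultimately show ?thesis unfolding Qu using z j PQ(7) by auto
      qed
      moreover have "u \<in> V" unfolding u_def using Suc inv by simp
      ultimately show ?thesis using Suc.IH[of u] Suc.prems False by simp
    qed
  qed
  from this[of n w] that w show thesis by auto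
qed

lemma eigenspace_invariant:
  fixes X Y :: "complex mat"
  assumes X: "X \<in> carrier_mat n n" and Y: "Y \<in> carrier_mat n n" and comm: "X * Y = Y * X"
    and u: "u \<in> carrier_vec n" "X *\<^sub>v u = a \<cdot>\<^sub>v u"
  shows "X *\<^sub>v (Y *\<^sub>v u - c \<cdot>\<^sub>v u) = a \<cdot>\<^sub>v (Y *\<^sub>v u - c \<cdot>\<^sub>v u)"
proof -
  have "X *\<^sub>v (Y *\<^sub>v u) = Y *\<^sub>v (X *\<^sub>v u)"
    using assoc_mult_mat_vec[OF X Y u(1)] assoc_mult_mat_vec[OF Y X u(1)] comm by simp
  also have "\<dots> = a \<cdot>\<^sub>v (Y *\<^sub>v u)" unfolding u(2) by (rule mult_mat_vec[OF Y u(1)])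
  finally have XY: "X *\<^sub>v (Y *\<^sub>v u) = a \<cdot>\<^sub>v (Y *\<^sub>v u)" .
  have "X *\<^sub>v (Y *\<^sub>v u - c \<cdot>\<^sub>v u) = X *\<^sub>v (Y *\<^sub>v u) - c \<cdot>\<^sub>v (X *\<^sub>v u)"
    using X Y u(1) by (simp add: mult_minus_distrib_mat_vec[of X n n] mult_mat_vec[of X n n])
  then show ?thesis unfolding XY u(2)
    using Y u(1) by (intro eq_vecI) (simp_all add: right_diff_distrib)
qed

lemma commuting_eigenvector:
  fixes X Y :: "complex mat"
  assumes X: "X \<in> carrier_mat n n" and Y: "Y \<in> carrier_mat n n" and comm: "X * Y = Y * X"
    and ev: "eigenvalue X a"
  obtains u c where "eigenvector X u a" and "eigenvector Y u c"
proof -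
  define V where "V = {u \<in> carrier_vec n. X *\<^sub>v u = a \<cdot>\<^sub>v u}"
  obtain w where "w \<in> V" "w \<noteq> 0\<^sub>v n"
    using ev X by (auto simp: eigenvalue_def eigenvector_iff V_def)
  moreover have "Y *\<^sub>v u - c \<cdot>\<^sub>v u \<in> V" if "u \<in> V" for u c
    using that eigenspace_invariant[OF X Y comm] Y by (simp add: V_def)
  ultimately obtain u c where "u \<in> V" "eigenvector Y u c"
    using invariant_space_eigenvector[OF Y, of V w] unfolding V_def by blast
  then show thesis using that[of u c] X Y by (auto simp: V_def eigenvector_iff)
qed

text \<open>The matrix \<open>M\<close> is the sum of \<open>X^i Y^(k-1-i)\<close> over
  \<open>i < k\<close>, built by \<open>M' = M X + Y^k\<close>. On a common eigenvector with equal
  eigenvalue \<open>c\<close> each of the \<open>k\<close> summands acts as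
  \<open>c^(k-1)\<close>.\<close>

lemma pow_diff_factor_mat:
  fixes X Y :: "complex mat"
  assumes X: "X \<in> carrier_mat n n" and Y: "Y \<in> carrier_mat n n" and comm: "X * Y = Y * X"
  shows "\<exists>M \<in> carrier_mat n n. M * (X - Y) = X ^\<^sub>m k - Y ^\<^sub>m k \<and>
    (\<forall>u c. eigenvector X u c \<longrightarrow> eigenvector Y u c \<longrightarrow> M *\<^sub>v u = (of_nat k * c ^ (k - 1)) \<cdot>\<^sub>v u)"
proof (induction k)
  case 0
  have "0\<^sub>m n n *\<^sub>v u = 0 \<cdot>\<^sub>v u" if "u \<in> carrier_vec n" for u :: "complex vec"
    using that by (intro eq_vecI) auto
  then show ?case using X Y
    by (intro bexI[of _ "0\<^sub>m n n"]) (auto simp: eigenvector_iff)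
next
  case (Suc k)
  then obtain M where M: "M \<in> carrier_mat n n" "M * (X - Y) = X ^\<^sub>m k - Y ^\<^sub>m k"
    "\<And>u c. eigenvector X u c \<Longrightarrow> eigenvector Y u c \<Longrightarrow> M *\<^sub>v u = (of_nat k * c ^ (k - 1)) \<cdot>\<^sub>v u"
    by blast
  have D: "X - Y \<in> carrier_mat n n" and Xk: "X ^\<^sub>m k \<in> carrier_mat n n" and Yk: "Y ^\<^sub>m k \<in> carrier_mat n n"
    using X Y by (auto intro: minus_carrier_mat)
  have "M * X * (X - Y) = M * (X - Y) * X"
    using M(1) X Y D comm
    by (simp add: assoc_mult_mat[of M n n] mult_minus_distrib_mat[of X n n] minus_mult_distrib_mat[of X n n])
  then have "(M * X + Y ^\<^sub>m k) * (X - Y) = (X ^\<^sub>m k - Y ^\<^sub>m k) * X + Y ^\<^sub>m k * (X - Y)"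
    using M X D Yk by (simp add: add_mult_distrib_mat[of "M * X" n n])
  also have "\<dots> = (X ^\<^sub>m k * X - Y ^\<^sub>m k * X) + (Y ^\<^sub>m k * X - Y ^\<^sub>m k * Y)"
    using X Y Xk Yk by (simp add: minus_mult_distrib_mat[of _ n n] mult_minus_distrib_mat[of _ n n])
  also have "\<dots> = X ^\<^sub>m Suc k - Y ^\<^sub>m Suc k"
    using X Y by (intro eq_matI) auto
  finally have 1: "(M * X + Y ^\<^sub>m k) * (X - Y) = X ^\<^sub>m Suc k - Y ^\<^sub>m Suc k" .
  have "(M * X + Y ^\<^sub>m k) *\<^sub>v u = (of_nat (Suc k) * c ^ (Suc k - 1)) \<cdot>\<^sub>v u"
    if u: "eigenvector X u c" "eigenvector Y u c" for u c
  proof -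
    have uc: "u \<in> carrier_vec n" "X *\<^sub>v u = c \<cdot>\<^sub>v u" using u X by (auto simp: eigenvector_iff)
    have "M *\<^sub>v (X *\<^sub>v u) = (c * (of_nat k * c ^ (k - 1))) \<cdot>\<^sub>v u"
      unfolding uc(2) by (simp add: mult_mat_vec[OF M(1) uc(1)] M(3)[OF u] smult_smult_assoc)
    also have "c * (of_nat k * c ^ (k - 1)) = of_nat k * c ^ k" by (cases k) simp_all
    finally have "(M * X + Y ^\<^sub>m k) *\<^sub>v u = (of_nat k * c ^ k) \<cdot>\<^sub>v u + c ^ k \<cdot>\<^sub>v u"
      using M(1) X Yk uc(1) eigenvector_pow[OF Y u(2), of k]
      by (simp add: add_mult_distrib_mat_vec[of "M * X" n n] assoc_mult_mat_vec[of M n n X n u])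
    then show ?thesis by (simp add: add_smult_distrib_vec[symmetric] algebra_simps)
  qed
  then show ?case using 1 M(1) X Yk by (intro bexI[of _ "M * X + Y ^\<^sub>m k"]) auto
qed

section \<open>Uniqueness among commuting principal roots\<close>

text \<open>Within the sector \<open>p * Ln z\<close> stays in the principal strip, so it equals
  \<open>Ln (z ^ p)\<close>, and \<open>z\<close> can be recovered from
  \<open>z ^ p\<close>.\<close>

lemma sector_root_unique:
  assumes "p \<ge> 1" and "a \<noteq> 0" and "b \<noteq> 0" and "\<bar>Arg a\<bar> < pi / real p" and "\<bar>Arg b\<bar> < pi / real p"
    and "a ^ p = b ^ p"
  shows "a = b"
proof -
  have Ln: "Ln (z ^ p) = of_nat p * Ln z" if "z \<noteq> 0" "\<bar>Arg z\<bar> < pi / real p" for z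
  proof (rule Ln_unique)
    show "exp (of_nat p * Ln z) = z ^ p" using that by (simp add: exp_of_nat_mult)
    have "real p * \<bar>Im (Ln z)\<bar> < pi"
      using that assms(1) by (simp add: Arg_eq_Im_Ln field_simps)
    then have "\<bar>Im (of_nat p * Ln z)\<bar> < pi" by (simp add: abs_mult)
    then show "- pi < Im (of_nat p * Ln z)" "Im (of_nat p * Ln z) \<le> pi" by linarith+
  qed
  have "of_nat p * Ln a = of_nat p * Ln b" using Ln assms by metis
  then have "Ln a = Ln b" using assms(1) by simp
  then show ?thesis using assms(2,3) by (metis exp_Ln)
qed

lemma commuting_principal_root_unique:
  assumes p: "p \<ge> 1" and A: "A \<in> carrier_mat n n"
    and X: "is_principal_root p A X" and Y: "is_principal_root p A Y" and comm: "X * Y = Y * X"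
  shows "X = Y"
proof (rule ccontr)
  assume "X \<noteq> Y"
  have Xc: "X \<in> carrier_mat n n" and Yc: "Y \<in> carrier_mat n n" and XYp: "X ^\<^sub>m p = A" "Y ^\<^sub>m p = A"
    using X Y A by (auto simp: is_principal_root_def)
  define D where "D = X - Y"
  have Dc: "D \<in> carrier_mat n n" using Yc unfolding D_def by (rule minus_carrier_mat)
  obtain M where M: "M \<in> carrier_mat n n" "M * D = 0\<^sub>m n n"
    "\<And>u c. eigenvector X u c \<Longrightarrow> eigenvector Y u c \<Longrightarrow> M *\<^sub>v u = (of_nat p * c ^ (p - 1)) \<cdot>\<^sub>v u"
    using pow_diff_factor_mat[OF Xc Yc comm, of p] A unfolding XYp D_def by auto
  \<comment> \<open>The range of \<open>D\<close> is invariant under \<open>X\<close> and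
    \<open>Y\<close>, which both commute with \<open>D\<close>, and \<open>M\<close> annihilates
    it.\<close>
  define V where "V = (\<lambda>e. D *\<^sub>v e) ` carrier_vec n"
  have V: "V \<subseteq> carrier_vec n" using Dc by (auto simp: V_def)
  have inv: "Z *\<^sub>v u - c \<cdot>\<^sub>v u \<in> V" if Z: "Z \<in> carrier_mat n n" "Z * D = D * Z" and u: "u \<in> V" for Z u c
  proof -
    obtain e where e: "e \<in> carrier_vec n" "u = D *\<^sub>v e" using u by (auto simp: V_def)
    have "Z *\<^sub>v u = D *\<^sub>v (Z *\<^sub>v e)"
      using assoc_mult_mat_vec[OF Z(1) Dc e(1)] assoc_mult_mat_vec[OF Dc Z(1) e(1)] Z(2) e(2) by simp
    then have "Z *\<^sub>v u - c \<cdot>\<^sub>v u = D *\<^sub>v (Z *\<^sub>v e - c \<cdot>\<^sub>v e)"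
      using Z(1) Dc e by (simp add: mult_minus_distrib_mat_vec[of D n n] mult_mat_vec[of D n n])
    then show ?thesis using Z(1) e(1) by (auto simp: V_def)
  qed
  have XD: "X * D = D * X" and YD: "Y * D = D * Y"
    using Xc Yc comm unfolding D_def
    by (simp_all add: mult_minus_distrib_mat[of _ n n] minus_mult_distrib_mat[of _ n n])
  have "\<exists>j<n. col D j \<noteq> 0\<^sub>v n"
  proof (rule ccontr)
    assume "\<not> (\<exists>j<n. col D j \<noteq> 0\<^sub>v n)"
    then have col: "col D j = 0\<^sub>v n" if "j < n" for j using that by blast
    have "X $$ (i, j) = Y $$ (i, j)" if "i < n" "j < n" for i j
    proof -
      have "D $$ (i, j) = vec_index (col D j) i" using that Dc by simp
      then have "D $$ (i, j) = 0" using col[OF that(2)] that(1) by simp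
      then show ?thesis using that Xc Yc by (simp add: D_def)
    qed
    then show False using \<open>X \<noteq> Y\<close> Xc Yc by (metis eq_matI carrier_matD)
  qed
  then obtain j where j: "j < n" "col D j \<noteq> 0\<^sub>v n" by blast
  have "D *\<^sub>v unit_vec n j \<in> V" by (simp add: V_def)
  moreover have "D *\<^sub>v unit_vec n j = col D j"
    using Dc j by (intro eq_vecI) auto
  ultimately have "col D j \<in> V" by simp
  from invariant_space_eigenvector[OF Yc V inv[OF Yc YD] this j(2)]
  obtain w b where w: "w \<in> V" "eigenvector Y w b" by blast
  \<comment> \<open>Cutting down to an eigenspace of \<open>Y\<close> makes the eigenvector of
    \<open>X\<close> found next a common one.\<close>
  define V' where "V' = {u \<in> V. Y *\<^sub>v u = b \<cdot>\<^sub>v u}"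
  have wV': "w \<in> V'" "w \<noteq> 0\<^sub>v n" using w Yc by (auto simp: V'_def eigenvector_iff)
  have V': "V' \<subseteq> carrier_vec n" using V by (auto simp: V'_def)
  have inv': "X *\<^sub>v u - c \<cdot>\<^sub>v u \<in> V'" if "u \<in> V'" for u c
    using that inv[OF Xc XD] eigenspace_invariant[OF Yc Xc comm[symmetric]] V
    by (auto simp: V'_def)
  obtain u a where u: "u \<in> V'" "eigenvector X u a"
    using invariant_space_eigenvector[OF Xc V' inv' wV'] by blast
  have ub: "eigenvector Y u b" and u0: "u \<noteq> 0\<^sub>v n" "u \<in> carrier_vec n"
    using u Xc Yc by (auto simp: V'_def eigenvector_iff)
  obtain i where i: "i < n" "vec_index u i \<noteq> 0"
    using u0 by (metis carrier_vecD eq_vecI index_zero_vec)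
  have "a ^ p \<cdot>\<^sub>v u = b ^ p \<cdot>\<^sub>v u"
    using eigenvector_pow[OF Xc u(2), of p] eigenvector_pow[OF Yc ub, of p] unfolding XYp by simp
  then have "vec_index (a ^ p \<cdot>\<^sub>v u) i = vec_index (b ^ p \<cdot>\<^sub>v u) i" by simp
  then have "a ^ p = b ^ p" using i u0 by simp
  moreover have "eigenvalue X a" "eigenvalue Y b" using u ub by (auto simp: eigenvalue_def)
  ultimately have ab: "a = b" "a \<noteq> 0"
    using X Y sector_root_unique[OF p, of a b] by (auto simp: is_principal_root_def)
  obtain e where e: "e \<in> carrier_vec n" "u = D *\<^sub>v e" using u by (auto simp: V'_def V_def)
  have "M *\<^sub>v u = 0\<^sub>v n"
    unfolding e(2) assoc_mult_mat_vec[OF M(1) Dc e(1), symmetric] M(2)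
    using e(1) by (intro eq_vecI) auto
  \<comment> \<open>On the common eigenvector \<open>M\<close> also acts as
    \<open>p a^(p-1)\<close>, which is nonzero since a principal root has no eigenvalue 0.\<close>
  then have "(of_nat p * a ^ (p - 1)) \<cdot>\<^sub>v u = 0\<^sub>v n" using M(3)[OF u(2)] ub ab by simp
  then have "vec_index ((of_nat p * a ^ (p - 1)) \<cdot>\<^sub>v u) i = 0" using i by simp
  then show False using i u0 ab p by simp
qed

section \<open>The binomial series at B as principal root\<close>

context summable_mat
begin

abbreviation (input) cmat :: "real mat \<Rightarrow> complex mat" where
  "cmat \<equiv> map_mat complex_of_real"

lemma cmat_pow_index:
  "i < n \<Longrightarrow> j < n \<Longrightarrow> (cmat B ^\<^sub>m l) $$ (i, j) = complex_of_real ((B ^\<^sub>m l) $$ (i, j))"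
  using carrier by (simp flip: of_real_hom.mat_hom_pow[OF carrier])

lemma cmat_conv_sums:
  assumes "conv F" and "i < n" and "j < n"
  shows "(\<lambda>l. complex_of_real (fps_nth F l) * (cmat B ^\<^sub>m l) $$ (i, j)) sums (cmat (fps_eval F) $$ (i, j))"
proof -
  have "(\<lambda>l. fps_nth F l * (B ^\<^sub>m l) $$ (i, j)) sums (fps_eval F $$ (i, j))"
    using assms by (simp add: fps_eval_index conv_summable summable_sums)
  then have "(\<lambda>l. complex_of_real (fps_nth F l * (B ^\<^sub>m l) $$ (i, j))) sums
      complex_of_real (fps_eval F $$ (i, j))"
    by (rule sums_of_real)
  then show ?thesis using assms by (simp add: cmat_pow_index)
qed

text \<open>Summability forces the powers of \<open>B\<close> to tend to 0, whereas on the
  eigenvector they act as \<open>c ^ l\<close>, which stays away from 0 if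
  \<open>norm c >= 1\<close>.\<close>

lemma eigenvalue_norm_less_one:
  assumes "eigenvector (cmat B) w c"
  shows "norm c < 1"
proof (rule ccontr)
  assume c: "\<not> norm c < 1"
  have Bc: "cmat B \<in> carrier_mat n n" using carrier by simp
  have w: "w \<in> carrier_vec n" "w \<noteq> 0\<^sub>v n" using assms Bc by (auto simp: eigenvector_iff)
  then obtain i where i: "i < n" "vec_index w i \<noteq> 0"
    by (metis carrier_vecD eq_vecI index_zero_vec)
  have "(\<lambda>l. \<Sum>j<n. (cmat B ^\<^sub>m l) $$ (i, j) * vec_index w j) \<longlonglongrightarrow> (\<Sum>j<n. 0 * vec_index w j)"
  proof (intro tendsto_sum tendsto_mult tendsto_const)
    fix j assume "j \<in> {..<n}"
    then show "(\<lambda>l. (cmat B ^\<^sub>m l) $$ (i, j)) \<longlonglongrightarrow> 0"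
      using i tendsto_of_real[OF summable_LIMSEQ_zero[OF summable_pow[of i j]]]
      by (simp add: cmat_pow_index)
  qed
  moreover have "(\<Sum>j<n. (cmat B ^\<^sub>m l) $$ (i, j) * vec_index w j) = c ^ l * vec_index w i" for l
  proof -
    have "vec_index (cmat B ^\<^sub>m l *\<^sub>v w) i = vec_index (c ^ l \<cdot>\<^sub>v w) i"
      using eigenvector_pow[OF Bc assms] by simp
    then show ?thesis
      using index_mult_mat_vec_sum[OF pow_carrier_mat[OF Bc] w(1) i(1), of l] i w by simp
  qed
  ultimately have "(\<lambda>l. norm (c ^ l * vec_index w i)) \<longlonglongrightarrow> 0"
    by (simp add: tendsto_norm_zero)
  then have "norm (vec_index w i) \<le> 0"
  proof (rule tendsto_lowerbound)
    have "1 * norm (vec_index w i) \<le> norm c ^ l * norm (vec_index w i)" for l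
      using c by (intro mult_right_mono one_le_power) auto
    then show "eventually (\<lambda>l. norm (vec_index w i) \<le> norm (c ^ l * vec_index w i)) sequentially"
      by (simp add: norm_mult norm_power)
  qed simp
  then show False using i by simp
qed

lemma fps_eval_eigenvector:
  assumes "conv F" and ev: "eigenvector (cmat B) w c"
    and sums: "(\<lambda>l. complex_of_real (fps_nth F l) * c ^ l) sums s"
  shows "cmat (fps_eval F) *\<^sub>v w = s \<cdot>\<^sub>v w"
proof (rule eq_vecI)
  have Bc: "cmat B \<in> carrier_mat n n" using carrier by simp
  have w: "w \<in> carrier_vec n" using ev Bc by (auto simp: eigenvector_iff)
  have Fc: "cmat (fps_eval F) \<in> carrier_mat n n" by simp
  show "dim_vec (cmat (fps_eval F) *\<^sub>v w) = dim_vec (s \<cdot>\<^sub>v w)" using w by simp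
  fix i assume "i < dim_vec (s \<cdot>\<^sub>v w)"
  then have i: "i < n" using w by simp
  have "(\<lambda>l. \<Sum>j<n. complex_of_real (fps_nth F l) * (cmat B ^\<^sub>m l) $$ (i, j) * vec_index w j)
      sums (\<Sum>j<n. cmat (fps_eval F) $$ (i, j) * vec_index w j)"
    using cmat_conv_sums[OF assms(1) i] by (intro sums_sum sums_mult2) simp
  moreover have "(\<Sum>j<n. complex_of_real (fps_nth F l) * (cmat B ^\<^sub>m l) $$ (i, j) * vec_index w j)
      = complex_of_real (fps_nth F l) * c ^ l * vec_index w i" for l
  proof -
    have "vec_index (cmat B ^\<^sub>m l *\<^sub>v w) i = c ^ l * vec_index w i"
      using eigenvector_pow[OF Bc ev] i w by simp
    then show ?thesis
      using index_mult_mat_vec_sum[OF pow_carrier_mat[OF Bc] w i, of l]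
      by (simp add: mult.assoc flip: sum_distrib_left)
  qed
  ultimately have "(\<lambda>l. complex_of_real (fps_nth F l) * c ^ l * vec_index w i)
      sums (\<Sum>j<n. cmat (fps_eval F) $$ (i, j) * vec_index w j)" by simp
  moreover have "(\<lambda>l. complex_of_real (fps_nth F l) * c ^ l * vec_index w i) sums (s * vec_index w i)"
    using sums by (rule sums_mult2)
  ultimately have "(\<Sum>j<n. cmat (fps_eval F) $$ (i, j) * vec_index w j) = s * vec_index w i"
    by (rule sums_unique2)
  then show "vec_index (cmat (fps_eval F) *\<^sub>v w) i = vec_index (s \<cdot>\<^sub>v w) i"
    using index_mult_mat_vec_sum[OF Fc w i] i w by simp
qed

lemma fps_eval_commute:
  assumes "conv F" and Y: "Y \<in> carrier_mat n n" and comm: "cmat B * Y = Y * cmat B"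
  shows "cmat (fps_eval F) * Y = Y * cmat (fps_eval F)"
proof (rule eq_matI)
  have Bc: "cmat B \<in> carrier_mat n n" using carrier by simp
  have Fc: "cmat (fps_eval F) \<in> carrier_mat n n" by simp
  fix i j assume "i < dim_row (Y * cmat (fps_eval F))" "j < dim_col (Y * cmat (fps_eval F))"
  then have ij: "i < n" "j < n" using Y by simp_all
  have pow: "cmat B ^\<^sub>m l * Y = Y * cmat B ^\<^sub>m l" for l
  proof (induction l)
    case (Suc l)
    have "cmat B ^\<^sub>m Suc l * Y = cmat B ^\<^sub>m l * (Y * cmat B)"
      using Bc Y comm by (simp add: assoc_mult_mat[of _ n n _ n _ n])
    also have "\<dots> = Y * (cmat B ^\<^sub>m l * cmat B)"
      using Suc Bc Y by (simp flip: assoc_mult_mat[of _ n n _ n _ n])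
    finally show ?case by simp
  qed (use Bc Y in simp)
  let ?f = "\<lambda>l. complex_of_real (fps_nth F l)"
  have "(\<lambda>l. \<Sum>k<n. ?f l * (cmat B ^\<^sub>m l) $$ (i, k) * Y $$ (k, j))
      sums (\<Sum>k<n. cmat (fps_eval F) $$ (i, k) * Y $$ (k, j))"
    using cmat_conv_sums[OF assms(1) ij(1)] by (intro sums_sum sums_mult2) simp
  moreover have "(\<lambda>l. \<Sum>k<n. Y $$ (i, k) * (?f l * (cmat B ^\<^sub>m l) $$ (k, j)))
      sums (\<Sum>k<n. Y $$ (i, k) * cmat (fps_eval F) $$ (k, j))"
    using cmat_conv_sums[OF assms(1) _ ij(2)] by (intro sums_sum sums_mult) simp
  moreover have "(\<Sum>k<n. ?f l * (cmat B ^\<^sub>m l) $$ (i, k) * Y $$ (k, j))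
      = (\<Sum>k<n. Y $$ (i, k) * (?f l * (cmat B ^\<^sub>m l) $$ (k, j)))" for l
    using arg_cong[OF pow[of l], of "\<lambda>Z. ?f l * Z $$ (i, j)"]
    unfolding index_mult_mat_sum[OF pow_carrier_mat[OF Bc] Y ij] index_mult_mat_sum[OF Y pow_carrier_mat[OF Bc] ij]
    by (simp add: sum_distrib_left mult_ac)
  ultimately have "(\<Sum>k<n. cmat (fps_eval F) $$ (i, k) * Y $$ (k, j))
      = (\<Sum>k<n. Y $$ (i, k) * cmat (fps_eval F) $$ (k, j))"
    by (metis (no_types, lifting) sums_cong sums_unique2)
  then show "(cmat (fps_eval F) * Y) $$ (i, j) = (Y * cmat (fps_eval F)) $$ (i, j)"
    by (simp only: index_mult_mat_sum[OF Fc Y ij] index_mult_mat_sum[OF Y Fc ij])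
qed (use Y in simp_all)

lemma root_fps_sums:
  assumes "norm c < 1"
  shows "(\<lambda>l. complex_of_real (fps_nth (root_fps p) l) * c ^ l) sums ((1 - c) powr (1 / of_nat p))"
proof -
  have "(\<lambda>l. ((1 / of_nat p) gchoose l) * (- c) ^ l) sums (1 + (- c)) powr (1 / of_nat p)"
    by (rule gen_binomial_complex) (use assms in simp)
  moreover have "((1 / of_nat p) gchoose l) * (- c) ^ l = complex_of_real (fps_nth (root_fps p) l) * c ^ l" for l
  proof -
    have "pochhammer (- (1 / of_nat p)) l = complex_of_real (pochhammer (- 1 / real p) l)"
      by (simp flip: pochhammer_of_real)
    moreover have "(- c) ^ l = (- 1) ^ l * c ^ l" by (rule power_minus)
    \<comment> \<open>One sign comes from \<open>(- c) ^ l\<close>, the other from writing the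
      binomial coefficient as a Pochhammer symbol; they cancel.\<close>
    moreover have "(- 1) ^ l * (- 1) ^ l = (1 :: complex)" by (simp flip: power_mult_distrib)
    ultimately show ?thesis
      by (simp add: root_fps_def root_coeff_def gbinomial_pochhammer del: pochhammer_of_real)
  qed
  ultimately show ?thesis by simp
qed

text \<open>As \<open>1 - c\<close> lies in the right half plane, its logarithm has imaginary part
  below \<open>pi / 2\<close> in modulus; dividing by \<open>p\<close> puts the root into the
  sector.\<close>

lemma powr_inverse_sector:
  assumes "norm c < 1" and "p \<ge> 1"
  shows "(1 - c) powr (1 / of_nat p) \<noteq> 0" and "\<bar>Arg ((1 - c) powr (1 / of_nat p))\<bar> < pi / real p"
proof -
  have "Re c < 1" using assms(1) complex_Re_le_cmod[of c] by linarith
  then have pos: "0 < Re (1 - c)" by simp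
  then have ne: "1 - c \<noteq> 0" by (metis less_irrefl zero_complex.simps(1))
  then show "(1 - c) powr (1 / of_nat p) \<noteq> 0" by simp
  have im: "\<bar>Im (Ln (1 - c))\<bar> < pi / 2" using Re_Ln_pos_lt_imp[OF pos] .
  define z where "z = (1 / of_nat p) * Ln (1 - c)"
  have z: "Im z = Im (Ln (1 - c)) / real p" by (simp add: z_def Im_divide_of_nat)
  have "\<bar>Im z\<bar> < pi / real p"
    using im assms(2) pi_gt_zero unfolding z by (simp add: abs_divide divide_strict_right_mono)
  moreover have "pi / real p \<le> pi" using assms(2) by (simp add: divide_le_eq)
  ultimately have "Ln (exp z) = z" "\<bar>Im z\<bar> < pi / real p" by (auto intro!: Ln_unique)
  then show "\<bar>Arg ((1 - c) powr (1 / of_nat p))\<bar> < pi / real p"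
    using ne by (simp add: powr_def Arg_eq_Im_Ln z_def)
qed

lemma conv_root_fps: "p \<ge> 1 \<Longrightarrow> conv (root_fps p)"
  by (rule conv_bounded) (simp add: root_fps_def root_coeff_abs_le)

lemma root_fps_principal:
  assumes "p \<ge> 1"
  shows "is_principal_root p (cmat (1\<^sub>m n - B)) (cmat (fps_eval (root_fps p)))"
  unfolding is_principal_root_def
proof (intro conjI allI impI)
  let ?S = "fps_eval (root_fps p)"
  have Bc: "cmat B \<in> carrier_mat n n" and Sc: "cmat ?S \<in> carrier_mat n n" using carrier by simp_all
  show "cmat ?S \<in> carrier_mat (dim_row (cmat (1\<^sub>m n - B))) (dim_row (cmat (1\<^sub>m n - B)))"
    using carrier by simp
  have "?S ^\<^sub>m p = 1\<^sub>m n - B"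
    using assms by (simp add: conv_root_fps root_fps_power fps_eval_diff conv_one conv_X
        fps_eval_one fps_eval_X flip: fps_eval_power)
  then show "cmat ?S ^\<^sub>m p = cmat (1\<^sub>m n - B)"
    using of_real_hom.mat_hom_pow[OF fps_eval_carrier, of "root_fps p" p] by metis
  fix z assume "eigenvalue (cmat ?S) z"
  from commuting_eigenvector[OF Sc Bc fps_eval_commute[OF conv_root_fps[OF assms] Bc refl] this]
  obtain u c where u: "eigenvector (cmat ?S) u z" "eigenvector (cmat B) u c" by blast
  have c: "norm c < 1" using eigenvalue_norm_less_one u(2) .
  let ?s = "(1 - c) powr (1 / of_nat p)"
  have "z \<cdot>\<^sub>v u = ?s \<cdot>\<^sub>v u"
    using fps_eval_eigenvector[OF conv_root_fps[OF assms] u(2) root_fps_sums[OF c]] u(1)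
    unfolding eigenvector_iff[OF Sc] by simp
  then have eq: "vec_index (z \<cdot>\<^sub>v u) k = vec_index (?s \<cdot>\<^sub>v u) k" for k by simp
  obtain i where "i < n" "vec_index u i \<noteq> 0" "u \<in> carrier_vec n"
    using u(1) Sc unfolding eigenvector_iff[OF Sc] by (metis carrier_vecD eq_vecI index_zero_vec)
  then have "z = ?s" using eq[of i] by simp
  then show "z \<noteq> 0" "\<bar>Arg z\<bar> < pi / real p" using powr_inverse_sector[OF c assms] by simp_all
qed

text \<open>From \<open>Y^p = A\<close> it follows that \<open>Y\<close> commutes with
  \<open>A\<close>, hence with \<open>B = I - A\<close> and every convergent series in
  \<open>B\<close>; this reduces the claim to commuting roots.\<close>

lemma principal_root_unique:
  assumes "p \<ge> 1" and Y: "is_principal_root p (cmat (1\<^sub>m n - B)) Y"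
  shows "Y = cmat (fps_eval (root_fps p))"
proof -
  let ?A = "cmat (1\<^sub>m n - B)"
  have Ac: "?A \<in> carrier_mat n n" and Bc: "cmat B \<in> carrier_mat n n"
    using carrier minus_carrier_mat[OF carrier] by simp_all
  have Yc: "Y \<in> carrier_mat n n" and Yp: "Y ^\<^sub>m p = ?A" using Y carrier by (simp_all add: is_principal_root_def)
  have AY: "?A * Y = Y * ?A"
    using pow_mat_add[OF Yc, of p 1] pow_mat_add[OF Yc, of 1 p] Yp Yc by (simp add: add.commute)
  have B: "cmat B = 1\<^sub>m n - ?A" using carrier by (intro eq_matI) auto
  have "cmat B * Y = Y * cmat B"
    unfolding B using Yc AY
    by (simp add: minus_mult_distrib_mat[OF one_carrier_mat Ac Yc] mult_minus_distrib_mat[OF Yc one_carrier_mat Ac])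
  then have "cmat (fps_eval (root_fps p)) * Y = Y * cmat (fps_eval (root_fps p))"
    using fps_eval_commute[OF conv_root_fps[OF assms(1)] Yc] by simp
  then show ?thesis
    using commuting_principal_root_unique[OF assms(1) Ac root_fps_principal[OF assms(1)] Y] by simp
qed

end

section \<open>M-matrices\<close>

lemma pow_smult_mat:
  fixes A :: "'a::comm_semiring_1 mat"
  assumes A: "A \<in> carrier_mat n n"
  shows "(c \<cdot>\<^sub>m A) ^\<^sub>m k = c ^ k \<cdot>\<^sub>m (A ^\<^sub>m k)"
proof (induction k)
  case 0
  then show ?case using A by (intro eq_matI) auto
next
  case (Suc k)
  have "(c ^ k \<cdot>\<^sub>m A ^\<^sub>m k) * (c \<cdot>\<^sub>m A) = c ^ Suc k \<cdot>\<^sub>m (A ^\<^sub>m k * A)"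
  proof (rule eq_matI)
    fix i j assume "i < dim_row (c ^ Suc k \<cdot>\<^sub>m (A ^\<^sub>m k * A))" "j < dim_col (c ^ Suc k \<cdot>\<^sub>m (A ^\<^sub>m k * A))"
    then have ij: "i < n" "j < n" using A by simp_all
    have c1: "c ^ k \<cdot>\<^sub>m A ^\<^sub>m k \<in> carrier_mat n n" and c2: "c \<cdot>\<^sub>m A \<in> carrier_mat n n"
      and c3: "A ^\<^sub>m k \<in> carrier_mat n n" using A by simp_all
    have "((c ^ k \<cdot>\<^sub>m A ^\<^sub>m k) * (c \<cdot>\<^sub>m A)) $$ (i, j) = c ^ Suc k * (A ^\<^sub>m k * A) $$ (i, j)"
      unfolding index_mult_mat_sum[OF c1 c2 ij] index_mult_mat_sum[OF c3 A ij] sum_distrib_left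
      using A ij by (intro sum.cong) (simp_all add: mult_ac)
    then show "((c ^ k \<cdot>\<^sub>m A ^\<^sub>m k) * (c \<cdot>\<^sub>m A)) $$ (i, j) = (c ^ Suc k \<cdot>\<^sub>m (A ^\<^sub>m k * A)) $$ (i, j)"
      using A ij by simp
  qed (use A in simp_all)
  then show ?case using Suc by simp
qed

text \<open>Dividing by \<open>t\<close> brings the spectral radius below 1, where powers are
  bounded; scaling back produces the factor \<open>t ^ k\<close>.\<close>

lemma spectral_radius_pow_bound:
  fixes N :: "real mat"
  assumes N: "N \<in> carrier_mat n n" and n: "n > 0"
    and t: "spectral_radius (map_mat complex_of_real N) < t"
  obtains b where "\<And>k i j. i < n \<Longrightarrow> j < n \<Longrightarrow> \<bar>(N ^\<^sub>m k) $$ (i, j)\<bar> \<le> b * t ^ k"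
proof -
  define M where "M = map_mat complex_of_real N"
  have M: "M \<in> carrier_mat n n" using N by (simp add: M_def)
  have "spectral_radius M \<ge> 0" using spectral_radius_mem_max(1)[OF M n] by auto
  then have t0: "t > 0" using t by (simp add: M_def)
  define C where "C = complex_of_real (1 / t) \<cdot>\<^sub>m M"
  have C: "C \<in> carrier_mat n n" using M by (simp add: C_def)
  obtain c where c: "spectral_radius C = norm c" "eigenvalue C c"
    using spectral_radius_mem_max(1)[OF C n] by (auto simp: spectrum_def)
  obtain v where v: "eigenvector C v c" using c(2) by (auto simp: eigenvalue_def)
  then have v': "v \<in> carrier_vec n" "v \<noteq> 0\<^sub>v n" "C *\<^sub>v v = c \<cdot>\<^sub>v v" by (simp_all add: eigenvector_iff[OF C])
  \<comment> \<open>An extremal eigenvalue \<open>c\<close> of the scaled matrix gives the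
    eigenvalue \<open>t c\<close> of \<open>M\<close>, which bounds the spectral radius of
    \<open>C\<close>.\<close>
  have "M *\<^sub>v v = (complex_of_real t * c) \<cdot>\<^sub>v v"
  proof (rule eq_vecI)
    fix i assume "i < dim_vec ((complex_of_real t * c) \<cdot>\<^sub>v v)"
    then have i: "i < n" using v' by simp
    have "c * vec_index v i = vec_index (C *\<^sub>v v) i" using v' i by simp
    also have "\<dots> = (\<Sum>k<n. complex_of_real (1 / t) * (M $$ (i, k) * vec_index v k))"
      unfolding index_mult_mat_vec_sum[OF C v'(1) i] using i M
      by (intro sum.cong) (simp_all add: C_def)
    also have "\<dots> = complex_of_real (1 / t) * vec_index (M *\<^sub>v v) i"
      unfolding index_mult_mat_vec_sum[OF M v'(1) i] by (simp add: sum_distrib_left)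
    finally show "vec_index (M *\<^sub>v v) i = vec_index ((complex_of_real t * c) \<cdot>\<^sub>v v) i"
      using t0 v' i by (simp add: field_simps)
  qed (use v' M in simp)
  then have "eigenvalue M (complex_of_real t * c)"
    using v' by (auto simp: eigenvalue_def eigenvector_iff[OF M])
  then have "norm (complex_of_real t * c) \<le> spectral_radius M"
    by (intro spectral_radius_mem_max(2)[OF M n]) (auto simp: spectrum_def)
  then have "t * norm c \<le> spectral_radius M" using t0 by (simp add: norm_mult)
  then have "t * norm c < t * 1" using t unfolding M_def by linarith
  then have "spectral_radius C < 1" using t0 c(1) by simp
  then obtain b where b: "\<And>k. norm_bound (C ^\<^sub>m k) b"
    using spectral_radius_jnf_norm_bound_less_1_upper_triangular[OF C] by blast
  have "\<bar>(N ^\<^sub>m k) $$ (i, j)\<bar> \<le> b * t ^ k" if ij: "i < n" "j < n" for i j k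
  proof -
    have "norm ((C ^\<^sub>m k) $$ (i, j)) \<le> b" using b[of k] C ij by (simp add: norm_bound_def)
    moreover have "(C ^\<^sub>m k) $$ (i, j) = complex_of_real ((1 / t) ^ k * (N ^\<^sub>m k) $$ (i, j))"
      using ij N M unfolding C_def pow_smult_mat[OF M]
      by (simp add: M_def flip: of_real_hom.mat_hom_pow[OF N])
    ultimately have "\<bar>(1 / t) ^ k * (N ^\<^sub>m k) $$ (i, j)\<bar> \<le> b" by (simp only: norm_of_real)
    then show ?thesis using t0 by (simp add: abs_mult power_one_over field_simps)
  qed
  then show thesis by (rule that)
qed

text \<open>With \<open>P = \<Sum>l<L. N\<^sup>l / s\<^sup>l\<^sup>+\<^sup>1\<close>, an approximate nonnegative inverse of \<open>A\<close>, and
  \<open>Q = \<Sum>l<K. B\<^sup>l\<close>, evaluating \<open>Q A P\<close> in two ways bounds \<open>Q\<close> by \<open>P\<close> as \<open>L\<close> tends to infinity.\<close>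

lemma M1_matrix_summable_mat:
  assumes n: "n > 0" and A: "A \<in> carrier_mat n n" and M1: "A \<in> M1_matrices"
  shows "summable_mat n (1\<^sub>m n - A)"
proof -
  define B where "B = 1\<^sub>m n - A"
  have B: "B \<in> carrier_mat n n" unfolding B_def using A by (rule minus_carrier_mat)
  obtain s N where N: "N \<in> carrier_mat n n" and N0: "0\<^sub>m n n \<le> N"
    and s: "spectral_radius (map_mat complex_of_real N) < s" and A_eq: "A = s \<cdot>\<^sub>m 1\<^sub>m n - N"
    using M1 A unfolding M1_matrices_def nonsingular_M_matrix_def by auto
  have N_nonneg: "0 \<le> N $$ (i, j)" if "i < n" "j < n" for i j
    using N0 N that unfolding less_eq_mat_def by auto
  \<comment> \<open>Off the diagonal \<open>B\<close> equals \<open>N\<close>; on the diagonal the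
    bound 1 on the entries of \<open>A\<close> decides.\<close>
  have B_nonneg: "0 \<le> B $$ (i, j)" if "i < n" "j < n" for i j
  proof (cases "i = j")
    case True
    then have "A $$ (i, j) \<le> 1" using M1 A that by (auto simp: M1_matrices_def)
    then show ?thesis using A that True by (simp add: B_def)
  next
    case False
    then show ?thesis using N N_nonneg[OF that] that by (simp add: B_def A_eq)
  qed
  define t where "t = (spectral_radius (map_mat complex_of_real N) + s) / 2"
  have "spectral_radius (map_mat complex_of_real N) \<ge> 0"
    using spectral_radius_mem_max(1)[of "map_mat complex_of_real N" n] N n by auto
  then have t: "0 < t" "t < s" "spectral_radius (map_mat complex_of_real N) < t"
    using s by (simp_all add: t_def)
  obtain b where b: "\<And>k i j. i < n \<Longrightarrow> j < n \<Longrightarrow> \<bar>(N ^\<^sub>m k) $$ (i, j)\<bar> \<le> b * t ^ k"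
    using spectral_radius_pow_bound[OF N n t(3)] by blast
  have s0: "s > 0" using t by simp
  define q where "q = t / s"
  have q: "0 < q" "q < 1" using t by (simp_all add: q_def)
  have Nl: "N ^\<^sub>m l \<in> carrier_mat n n" and Bl: "B ^\<^sub>m l \<in> carrier_mat n n" for l using N B by simp_all
  have N_le: "(N ^\<^sub>m l) $$ (i, j) / s ^ l \<le> b * q ^ l" if "i < n" "j < n" for i j l
    using b[OF that, of l] s0 by (simp add: q_def power_divide divide_right_mono)
  have b0: "b \<ge> 0" using b[of 0 0 0] n N by simp
  define P where "P L = mat n n (\<lambda>(i, j). \<Sum>l<L. (N ^\<^sub>m l) $$ (i, j) / s ^ Suc l)" for L :: nat
  define Q where "Q K = mat n n (\<lambda>(i, j). \<Sum>l<K. (B ^\<^sub>m l) $$ (i, j))" for K :: nat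
  have P: "P L \<in> carrier_mat n n" and Q: "Q L \<in> carrier_mat n n" for L by (simp_all add: P_def Q_def)
  have P_nonneg: "0 \<le> P L $$ (i, j)" if "i < n" "j < n" for L i j
    using that s0 pow_mat_nonneg[OF N N_nonneg that] by (auto simp: P_def intro!: sum_nonneg divide_nonneg_pos)
  have P_le: "P L $$ (i, j) \<le> b / s * (1 / (1 - q))" if "i < n" "j < n" for L i j
  proof -
    have "P L $$ (i, j) = (\<Sum>l<L. (N ^\<^sub>m l) $$ (i, j) / s ^ l / s)"
      using that by (simp add: P_def mult.commute)
    also have "\<dots> \<le> (\<Sum>l<L. b * q ^ l / s)"
      using that s0 by (intro sum_mono divide_right_mono N_le) auto
    also have "\<dots> = b / s * (\<Sum>l<L. q ^ l)" by (simp add: sum_distrib_left)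
    also have "\<dots> \<le> b / s * (\<Sum>l. q ^ l)"
      using q b0 s0 by (intro mult_left_mono sum_le_suminf summable_geometric) auto
    finally show ?thesis using q by (simp add: suminf_geometric)
  qed
  \<comment> \<open>Telescoping:
    \<open>A N^l / s^(l+1) = N^l / s^l - N^(l+1) / s^(l+1)\<close>.\<close>
  have AP: "(A * P L) $$ (i, j) = 1\<^sub>m n $$ (i, j) - (N ^\<^sub>m L) $$ (i, j) / s ^ L"
    if ij: "i < n" "j < n" for L i j
  proof -
    have step: "(\<Sum>k<n. A $$ (i, k) * (N ^\<^sub>m l) $$ (k, j)) = s * (N ^\<^sub>m l) $$ (i, j) - (N ^\<^sub>m Suc l) $$ (i, j)" for l
    proof -
      have "(\<Sum>k<n. A $$ (i, k) * (N ^\<^sub>m l) $$ (k, j))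
          = (\<Sum>k<n. (if k = i then s * (N ^\<^sub>m l) $$ (k, j) else 0) - N $$ (i, k) * (N ^\<^sub>m l) $$ (k, j))"
        using ij N by (intro sum.cong) (auto simp: A_eq left_diff_distrib)
      also have "\<dots> = s * (N ^\<^sub>m l) $$ (i, j) - (\<Sum>k<n. N $$ (i, k) * (N ^\<^sub>m l) $$ (k, j))"
        using ij by (simp add: sum_subtractf)
      also have "(\<Sum>k<n. N $$ (i, k) * (N ^\<^sub>m l) $$ (k, j)) = (N * N ^\<^sub>m l) $$ (i, j)"
        by (rule index_mult_mat_sum[OF N Nl ij, symmetric])
      also have "N * N ^\<^sub>m l = N ^\<^sub>m Suc l" using pow_mat_add[OF N, of 1 l] N by simp
      finally show ?thesis .
    qed
    have "(A * P L) $$ (i, j) = (\<Sum>k<n. \<Sum>l<L. A $$ (i, k) * (N ^\<^sub>m l) $$ (k, j) / s ^ Suc l)"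
      unfolding index_mult_mat_sum[OF A P ij] using ij by (simp add: P_def sum_distrib_left)
    also have "\<dots> = (\<Sum>l<L. (\<Sum>k<n. A $$ (i, k) * (N ^\<^sub>m l) $$ (k, j)) / s ^ Suc l)"
      by (subst sum.swap) (simp add: sum_divide_distrib)
    also have "\<dots> = (\<Sum>l<L. (N ^\<^sub>m l) $$ (i, j) / s ^ l - (N ^\<^sub>m Suc l) $$ (i, j) / s ^ Suc l)"
      unfolding step using s0 by (intro sum.cong) (simp_all add: diff_divide_distrib del: pow_mat.simps)
    also have "\<dots> = (N ^\<^sub>m 0) $$ (i, j) / s ^ 0 - (N ^\<^sub>m L) $$ (i, j) / s ^ L"
      by (rule sum_lessThan_telescope')
    finally show ?thesis using N by simp
  qed
  have QA: "(Q K * A) $$ (i, j) = 1\<^sub>m n $$ (i, j) - (B ^\<^sub>m K) $$ (i, j)" if ij: "i < n" "j < n" for K i j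
  proof -
    have AB: "A = 1\<^sub>m n - B" using A by (intro eq_matI) (auto simp: B_def)
    have step: "(\<Sum>k<n. (B ^\<^sub>m l) $$ (i, k) * A $$ (k, j)) = (B ^\<^sub>m l) $$ (i, j) - (B ^\<^sub>m Suc l) $$ (i, j)" for l
    proof -
      have "B ^\<^sub>m l * A = B ^\<^sub>m l - B ^\<^sub>m Suc l"
        unfolding AB using B by (simp add: mult_minus_distrib_mat[OF Bl one_carrier_mat B] right_mult_one_mat[OF Bl])
      then show ?thesis
        using index_mult_mat_sum[OF Bl A ij, of l] ij B by (simp del: index_mult_mat pow_mat.simps)
    qed
    have "(Q K * A) $$ (i, j) = (\<Sum>k<n. \<Sum>l<K. (B ^\<^sub>m l) $$ (i, k) * A $$ (k, j))"
      unfolding index_mult_mat_sum[OF Q A ij] using ij by (simp add: Q_def sum_distrib_right)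
    also have "\<dots> = (\<Sum>l<K. (B ^\<^sub>m l) $$ (i, j) - (B ^\<^sub>m Suc l) $$ (i, j))"
      unfolding step[symmetric] by (rule sum.swap)
    also have "\<dots> = (B ^\<^sub>m 0) $$ (i, j) - (B ^\<^sub>m K) $$ (i, j)"
      by (rule sum_lessThan_telescope')
    finally show ?thesis using B by simp
  qed
  \<comment> \<open>The bound must not depend on \<open>K\<close>. The splittings
    \<open>I - B\<close> and \<open>s I - N\<close> may differ, so the powers of \<open>B\<close>
    are controlled through their common value \<open>A\<close>.\<close>
  have bound: "Q K $$ (i, j) \<le> b / s * (1 / (1 - q))" if ij: "i < n" "j < n" for K i j
  proof (rule LIMSEQ_le_const2)
    have "(\<lambda>L. (N ^\<^sub>m L) $$ (k, j) / s ^ L) \<longlonglongrightarrow> 0" if k: "k < n" for k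
    proof (rule tendsto_sandwich[of "\<lambda>_. 0" _ _ "\<lambda>L. b * q ^ L"])
      show "(\<lambda>L. b * q ^ L) \<longlonglongrightarrow> 0"
        using q by (intro tendsto_mult_right_zero LIMSEQ_power_zero) simp
    qed (use k ij s0 pow_mat_nonneg[OF N N_nonneg] N_le in \<open>simp_all add: always_eventually\<close>)
    then have "(\<lambda>L. Q K $$ (i, j) - (\<Sum>k<n. Q K $$ (i, k) * ((N ^\<^sub>m L) $$ (k, j) / s ^ L)))
        \<longlonglongrightarrow> Q K $$ (i, j) - (\<Sum>k<n. Q K $$ (i, k) * 0)"
      by (intro tendsto_intros) simp
    then show "(\<lambda>L. Q K $$ (i, j) - (\<Sum>k<n. Q K $$ (i, k) * ((N ^\<^sub>m L) $$ (k, j) / s ^ L)))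
        \<longlonglongrightarrow> Q K $$ (i, j)" by simp
    have "Q K $$ (i, j) - (\<Sum>k<n. Q K $$ (i, k) * ((N ^\<^sub>m L) $$ (k, j) / s ^ L)) \<le> b / s * (1 / (1 - q))" for L
    proof -
      have AP': "A * P L \<in> carrier_mat n n" and QA': "Q K * A \<in> carrier_mat n n"
        using mult_carrier_mat[OF A P] mult_carrier_mat[OF Q A] by auto
      have "Q K $$ (i, j) - (\<Sum>k<n. Q K $$ (i, k) * ((N ^\<^sub>m L) $$ (k, j) / s ^ L))
          = (\<Sum>k<n. (if k = j then Q K $$ (i, k) else 0) - Q K $$ (i, k) * ((N ^\<^sub>m L) $$ (k, j) / s ^ L))"
        using ij by (simp add: sum_subtractf)
      also have "\<dots> = (\<Sum>k<n. Q K $$ (i, k) * (A * P L) $$ (k, j))"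
        using ij AP by (intro sum.cong) (auto simp: right_diff_distrib simp del: index_mult_mat)
      also have "\<dots> = (Q K * (A * P L)) $$ (i, j)"
        by (rule index_mult_mat_sum[OF Q AP' ij, symmetric])
      also have "\<dots> = ((Q K * A) * P L) $$ (i, j)" by (simp add: assoc_mult_mat[OF Q A P])
      also have "\<dots> = (\<Sum>k<n. (Q K * A) $$ (i, k) * P L $$ (k, j))"
        by (rule index_mult_mat_sum[OF QA' P ij])
      \<comment> \<open>Here \<open>Q A = I - B^K\<close> is at most \<open>I\<close> because
        \<open>B >= 0\<close>, and multiplying by \<open>P >= 0\<close> keeps the
        inequality.\<close>
      also have "\<dots> \<le> (\<Sum>k<n. if k = i then P L $$ (k, j) else 0)"
        using ij QA P_nonneg pow_mat_nonneg[OF B B_nonneg]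
        by (intro sum_mono) (auto simp: left_diff_distrib simp del: index_mult_mat)
      also have "\<dots> = P L $$ (i, j)" using ij by simp
      also have "\<dots> \<le> b / s * (1 / (1 - q))" by (rule P_le[OF ij])
      finally show ?thesis .
    qed
    then show "\<exists>M. \<forall>L\<ge>M. Q K $$ (i, j) - (\<Sum>k<n. Q K $$ (i, k) * ((N ^\<^sub>m L) $$ (k, j) / s ^ L))
        \<le> b / s * (1 / (1 - q))" by blast
  qed
  show ?thesis
    unfolding B_def[symmetric]
  proof
    fix i j assume ij: "i < n" "j < n"
    show "summable (\<lambda>l. (B ^\<^sub>m l) $$ (i, j))"
    proof (rule summableI_nonneg_bounded)
      fix K show "(\<Sum>l<K. (B ^\<^sub>m l) $$ (i, j)) \<le> b / s * (1 / (1 - q))"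
        using bound[OF ij, of K] ij by (simp add: Q_def)
    qed (rule pow_mat_nonneg[OF B B_nonneg ij])
  qed (use B B_nonneg in auto)
qed

text \<open>Invertibility makes \<open>the (mat_inverse X)\<close> in \<open>residual\<close> a true
  inverse, and unique existence makes the \<open>THE\<close> in \<open>principal_root\<close> denote
  the root. Convergence is entrywise over the complex numbers because \<open>principal_root\<close>
  is a complex matrix.\<close>

theorem theorem9:
  fixes p m n :: nat and A :: "real mat"
  assumes "p \<ge> 2" and "m \<ge> 1" and "n \<ge> 1"
    and "A \<in> carrier_mat n n" and "A \<in> M1_matrices"
  shows "(\<forall>k. invertible_mat (schroeder p m A k)) \<and>
    (\<exists>!X. is_principal_root p (map_mat complex_of_real A) X) \<and>
    (\<forall>k. schroeder p m A (Suc k) \<le> schroeder p m A k) \<and>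
    (\<forall>i<n. \<forall>j<n. (\<lambda>k. complex_of_real (schroeder p m A k $$ (i, j)))
        \<longlonglongrightarrow> principal_root p (map_mat complex_of_real A) $$ (i, j))"
proof -
  define B where "B = 1\<^sub>m n - A"
  interpret summable_mat n B
    unfolding B_def using assms by (intro M1_matrix_summable_mat) auto
  have A: "A = 1\<^sub>m n - B" using assms(4) by (intro eq_matI) (auto simp: B_def)
  have X: "schroeder p m A k = fps_eval (iter_series p m k)" for k
    unfolding A using assms by (intro schroeder_eq_fps_eval)
  have p: "p \<ge> 1" using assms(1) by simp
  note pm = assms(1,2)
  have conv: "conv (iter_series p m k)" "conv (inverse (iter_series p m k))" for k
    using iter_series_abs_le[OF pm] inverse_iter_series_abs_le[OF pm] by (auto intro: conv_bounded)
  have "invertible_mat (schroeder p m A k)" for k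
    unfolding X using inverse_mat_fps_eval(1)[OF conv iter_series_mult_inverse[OF pm]] .
  moreover have root: "is_principal_root p (cmat A) (cmat (fps_eval (root_fps p)))"
    unfolding A by (rule root_fps_principal[OF p])
  moreover have unique: "Y = cmat (fps_eval (root_fps p))" if "is_principal_root p (cmat A) Y" for Y
    using principal_root_unique[OF p] that unfolding A .
  moreover have "schroeder p m A (Suc k) \<le> schroeder p m A k" for k
    unfolding X by (rule fps_eval_mono[OF conv(1) conv(1) iter_series_decreasing[OF pm]])
  moreover have "(\<lambda>k. complex_of_real (schroeder p m A k $$ (i, j)))
      \<longlonglongrightarrow> principal_root p (cmat A) $$ (i, j)" if ij: "i < n" "j < n" for i j
  proof -
    have "principal_root p (cmat A) = cmat (fps_eval (root_fps p))"
      unfolding principal_root_def using root unique by (rule the_equality)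
    moreover have "(\<lambda>k. schroeder p m A k $$ (i, j)) \<longlonglongrightarrow> fps_eval (root_fps p) $$ (i, j)"
      unfolding X using ij iter_series_abs_le[OF pm] iter_series_nth_low[OF pm]
      by (intro fps_eval_tendsto) (simp_all add: root_fps_def)
    ultimately show ?thesis using ij by (simp add: tendsto_of_real)
  qed
  ultimately show ?thesis by blast
qed

end
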